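(* Let $\mathcal{M}$ be a Riemannian manifold with a retraction $\mathrm{R}$ and let $f\colon\mathcal{M}\to\mathbb{R}$ be three times continuously differentiable. Let $\{(x_0,s_0),(x_1,s_1),\ldots\}$ be the set of points and trial steps generated by the ARC algorithm (described in the context), and assume $\mathrm{R}$ is second-order nice on this set. If the sequence $x_0,x_1,x_2,\ldots$ remains in a compact subset of $\mathcal{M}$, then there is a constant $L$ such that, with $\hat f_k=f\circ\mathrm{R}_{x_k}$: at each iteration $k$, $$\hat f_k(s_k)-\Big[\hat f_k(0)+\langle s_k,\nabla\hat f_k(0)\rangle+\tfrac12\langle s_k,\nabla^2\hat f_k(0)[s_k]\rangle\Big]\le\frac L6\|s_k\|^3,$$ and at each successful iteration $k$, $$\big\|\nabla\hat f_k(s_k)-\nabla\hat f_k(0)-\nabla^2\hat f_k(0)[s_k]\big\|\le\frac L2\|s_k\|^2.$$ Moreover, the algorithm is a descent method, so that the condition that the sequence $x_0,x_1,\ldots$ remains in a compact subset holds in particular if the sublevel set $\{x\in\mathcal{M}:f(x)\le f(x_0)\}$ is compact, and a fortiori if $\mathcal{M}$ is compact.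
   Context: Notation. $\mathrm{T}_x\mathcal{M}$ is the tangent space at $x$ with Riemannian inner product $\langle\cdot,\cdot\rangle$ and norm $\|\cdot\|$; $\mathrm{T}\mathcal{M}$ is the tangent bundle; $\nabla,\nabla^2$ are the usual gradient and Hessian of functions on the Euclidean space $\mathrm{T}_x\mathcal{M}$; $\lambda_{\min}$ is the smallest eigenvalue. A retraction is a smooth map $\mathrm{R}\colon\mathrm{T}\mathcal{M}\to\mathcal{M}$, $(x,s)\mapsto\mathrm{R}_x(s)$, such that for each $x$, $\mathrm{R}_x(0)=x$ and $\mathrm{D}\mathrm{R}_x(0)$ is the identity on $\mathrm{T}_x\mathcal{M}$. Second-order nice. For $S\subseteq\mathrm{T}\mathcal{M}$, $\mathrm{R}$ is second-order nice on $S$ if there are constants $c_1,c_2,c_3$ such that for all $(x,s)\in S$ and all $\dot s\in\mathrm{T}_x\mathcal{M}$: (1) for all $t\in[0,1]$, $\|T_{ts}\|_{\mathrm{op}}\le c_1$ where $T_{ts}=\mathrm{D}\mathrm{R}_x(ts)$; (2) for all $t\in[0,1]$, the covariant derivative of $U(t)=T_{ts}\dot s$ (a vector field along $t\mapsto\mathrm{R}_x(ts)$) satisfies $\|\frac{\mathrm{D}}{\mathrm{d}t}U(t)\|\le c_2\|s\|\|\dot s\|$; (3) $\|c''(0)\|\le c_3\|s\|\|\dot s\|^2$ where $c(t)=\mathrm{R}_x(s+t\dot s)$ and $c''$ is its intrinsic acceleration (covariant derivative of $c'$). ARC algorithm with retraction $\mathrm{R}$. Parameters: $\theta>0$, $\varsigma_{\min}>0$,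 $0<\eta_1\le\eta_2<1$, $0<\gamma_1<1<\gamma_2<\gamma_3$. Input: $x_0\in\mathcal{M}$, $\varsigma_0\ge\varsigma_{\min}$. For $k=0,1,2,\ldots$: let $\hat f_k=f\circ\mathrm{R}_{x_k}\colon\mathrm{T}_{x_k}\mathcal{M}\to\mathbb{R}$ and define $m_k(s)=\hat f_k(0)+\langle s,\nabla\hat f_k(0)\rangle+\frac12\langle s,\nabla^2\hat f_k(0)[s]\rangle+\frac{\varsigma_k}{3}\|s\|^3$. A subproblem solver returns any $s_k\in\mathrm{T}_{x_k}\mathcal{M}$ satisfying $m_k(s_k)\le m_k(0)$ and $\|\nabla m_k(s_k)\|\le\theta\|s_k\|^2$ (optionally also $\lambda_{\min}(\nabla^2m_k(s_k))\ge-\theta\|s_k\|$). If $s_k=0$, terminate. Otherwise compute $\rho_k=\dfrac{f(x_k)-f(\mathrm{R}_{x_k}(s_k))}{m_k(0)-m_k(s_k)+\frac{\varsigma_k}{3}\|s_k\|^3}$. If $\rho_k\ge\eta_1$ (iteration $k$ is successful), set $x_{k+1}=\mathrm{R}_{x_k}(s_k)$; otherwise (unsuccessful) set $x_{k+1}=x_k$. Choose $\varsigma_{k+1}\in[\max(\varsigma_{\min},\gamma_1\varsigma_k),\varsigma_k]$ if $\rho_k\ge\eta_2$; $\varsigma_{k+1}\in[\varsigma_k,\gamma_2\varsigma_k]$ if $\rho_k\in[\eta_1,\eta_2)$; $\varsigma_{k+1}\in[\gamma_2\varsigma_k,\gamma_3\varsigma_k]$ if $\rho_k<\eta_1$. Descent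 method means $f(x_{k+1})\le f(x_k)$ for all $k$. *)

theory Defs
  imports "HOL-Analysis.Analysis" "HOL-Library.Function_Algebras"
begin

instantiation "fun" :: (type, real_vector) real_vector
begin

definition scaleR_fun :: "real \<Rightarrow> ('a \<Rightarrow> 'b) \<Rightarrow> 'a \<Rightarrow> 'b"
  where "scaleR_fun a v = (\<lambda>i. a *\<^sub>R v i)"

instance
  by standard (auto simp: scaleR_fun_def fun_eq_iff scaleR_add_left scaleR_add_right)

end

text \<open>Class \<open>C\<^sup>n\<close>, only used for open \<open>S\<close>. For a finite-dimensional domain, having all directional
  derivatives of class \<open>C\<^sup>n\<close> is the same as having a Frechet derivative of class \<open>C\<^sup>n\<close>.\<close>

primrec Ck_on :: "nat \<Rightarrow> 'a::euclidean_space set \<Rightarrow> ('a \<Rightarrow> 'b::real_normed_vector) \<Rightarrow> bool" where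
  "Ck_on 0 S f \<longleftrightarrow> continuous_on S f"
| "Ck_on (Suc n) S f \<longleftrightarrow>
     (\<forall>x\<in>S. f differentiable (at x)) \<and> (\<forall>v. Ck_on n S (\<lambda>x. frechet_derivative f (at x) v))"

definition smooth_on :: "'a::euclidean_space set \<Rightarrow> ('a \<Rightarrow> 'b::real_normed_vector) \<Rightarrow> bool"
  where "smooth_on S f \<longleftrightarrow> (\<forall>n. Ck_on n S f)"

text \<open>A chart is a pair of its domain and its coordinate map (irrelevant outside the domain).
  A tangent vector is the family of its coordinate vectors in all charts of the atlas.\<close>

type_synonym ('m, 'e) chart = "'m set \<times> ('m \<Rightarrow> 'e)"
type_synonym ('m, 'e) tvec = "('m, 'e) chart \<Rightarrow> 'e"

record ('m, 'e) manifold =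
  mtop :: "'m topology"
  atlas :: "('m, 'e) chart set"
  rmetric :: "'m \<Rightarrow> ('m, 'e) tvec \<Rightarrow> ('m, 'e) tvec \<Rightarrow> real"

abbreviation chart_dom :: "('m, 'e) chart \<Rightarrow> 'm set"
  where "chart_dom c \<equiv> fst c"

abbreviation chart_map :: "('m, 'e) chart \<Rightarrow> 'm \<Rightarrow> 'e"
  where "chart_map c \<equiv> snd c"

definition chart_inv :: "('m, 'e) chart \<Rightarrow> 'e \<Rightarrow> 'm"
  where "chart_inv c = inv_into (chart_dom c) (chart_map c)"

definition chart_img :: "('m, 'e) chart \<Rightarrow> 'e set"
  where "chart_img c = chart_map c ` chart_dom c"

definition carrier :: "('m, 'e) manifold \<Rightarrow> 'm set"
  where "carrier M = topspace (mtop M)"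

definition charts_at :: "('m, 'e) manifold \<Rightarrow> 'm \<Rightarrow> ('m, 'e) chart set"
  where "charts_at M x = {c \<in> atlas M. x \<in> chart_dom c}"

definition smooth_manifold :: "('m, 'e::euclidean_space) manifold \<Rightarrow> bool" where
  "smooth_manifold M \<longleftrightarrow>
     Hausdorff_space (mtop M) \<and> second_countable (mtop M) \<and>
     (\<Union>c\<in>atlas M. chart_dom c) = carrier M \<and>
     (\<forall>c\<in>atlas M. openin (mtop M) (chart_dom c) \<and> open (chart_img c) \<and>
        homeomorphic_map (subtopology (mtop M) (chart_dom c)) (top_of_set (chart_img c)) (chart_map c)) \<and>
     (\<forall>c\<in>atlas M. \<forall>d\<in>atlas M.
        smooth_on (chart_map c ` (chart_dom c \<inter> chart_dom d)) (chart_map d \<circ> chart_inv c))"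

definition transition_deriv ::
  "('m, 'e::euclidean_space) chart \<Rightarrow> ('m, 'e) chart \<Rightarrow> 'm \<Rightarrow> 'e \<Rightarrow> 'e"
  where "transition_deriv c d x = frechet_derivative (chart_map d \<circ> chart_inv c) (at (chart_map c x))"

definition tspace :: "('m, 'e::euclidean_space) manifold \<Rightarrow> 'm \<Rightarrow> ('m, 'e) tvec set" where
  "tspace M x = {v. (\<forall>c\<in>charts_at M x. \<forall>d\<in>charts_at M x. v d = transition_deriv c d x (v c)) \<and>
                    (\<forall>c. c \<notin> charts_at M x \<longrightarrow> v c = 0)}"

text \<open>The tangent vector at \<open>x\<close> whose coordinate vector in the chart \<open>c\<close> is \<open>\<xi>\<close>.\<close>

definition tlift ::
  "('m, 'e::euclidean_space) manifold \<Rightarrow> ('m, 'e) chart \<Rightarrow> 'm \<Rightarrow> 'e \<Rightarrow> ('m, 'e) tvec"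
  where "tlift M c x \<xi> = (\<lambda>d. if d \<in> charts_at M x then transition_deriv c d x \<xi> else 0)"

text \<open>The metric in local coordinates: \<open>metric_coeff M c u e\<^sub>i e\<^sub>j = g\<^sub>i\<^sub>j(u)\<close>.\<close>

definition metric_coeff ::
  "('m, 'e::euclidean_space) manifold \<Rightarrow> ('m, 'e) chart \<Rightarrow> 'e \<Rightarrow> 'e \<Rightarrow> 'e \<Rightarrow> real"
  where "metric_coeff M c u \<xi> \<eta> =
    (let x = chart_inv c u in rmetric M x (tlift M c x \<xi>) (tlift M c x \<eta>))"

definition riemannian_manifold :: "('m, 'e::euclidean_space) manifold \<Rightarrow> bool" where
  "riemannian_manifold M \<longleftrightarrow>
     smooth_manifold M \<and>
     (\<forall>x\<in>carrier M. \<forall>v\<in>tspace M x.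
        (\<forall>w\<in>tspace M x. rmetric M x v w = rmetric M x w v \<and>
           (\<forall>z\<in>tspace M x. rmetric M x (v + w) z = rmetric M x v z + rmetric M x w z) \<and>
           (\<forall>a. rmetric M x (a *\<^sub>R v) w = a * rmetric M x v w)) \<and>
        (v \<noteq> 0 \<longrightarrow> rmetric M x v v > 0)) \<and>
     (\<forall>c\<in>atlas M. \<forall>\<xi> \<eta>. smooth_on (chart_img c) (\<lambda>u. metric_coeff M c u \<xi> \<eta>))"

definition tnorm :: "('m, 'e) manifold \<Rightarrow> 'm \<Rightarrow> ('m, 'e) tvec \<Rightarrow> real"
  where "tnorm M x v = sqrt (rmetric M x v v)"

text \<open>Operator norm of a linear map from \<open>tspace M x\<close> to \<open>tspace M y\<close> (cf. \<^const>\<open>onorm\<close>).\<close>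

definition t_onorm ::
  "('m, 'e::euclidean_space) manifold \<Rightarrow> 'm \<Rightarrow> 'm \<Rightarrow> (('m, 'e) tvec \<Rightarrow> ('m, 'e) tvec) \<Rightarrow> real"
  where "t_onorm M x y T = (SUP v\<in>tspace M x. tnorm M y (T v) / tnorm M x v)"

definition Ck_function :: "nat \<Rightarrow> ('m, 'e::euclidean_space) manifold \<Rightarrow> ('m \<Rightarrow> real) \<Rightarrow> bool"
  where "Ck_function n M f \<longleftrightarrow> (\<forall>c\<in>atlas M. Ck_on n (chart_img c) (f \<circ> chart_inv c))"

definition velocity ::
  "('m, 'e::euclidean_space) manifold \<Rightarrow> (real \<Rightarrow> 'm) \<Rightarrow> real \<Rightarrow> ('m, 'e) tvec" where
  "velocity M \<gamma> t =
     (\<lambda>c. if c \<in> charts_at M (\<gamma> t) then vector_derivative (chart_map c \<circ> \<gamma>) (at t) else 0)"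

text \<open>Christoffel symbols of the Levi-Civita connection, as a bilinear map:
  \<open>christoffel M c u e\<^sub>i e\<^sub>j = \<Sum>\<^sub>k \<Gamma>\<^sup>k\<^sub>i\<^sub>j(u) e\<^sub>k\<close> is determined by
  \<open>\<Sum>\<^sub>k \<Gamma>\<^sup>k\<^sub>i\<^sub>j g\<^sub>k\<^sub>l = (\<partial>\<^sub>i g\<^sub>j\<^sub>l + \<partial>\<^sub>j g\<^sub>i\<^sub>l - \<partial>\<^sub>l g\<^sub>i\<^sub>j) / 2\<close>.\<close>

definition christoffel ::
  "('m, 'e::euclidean_space) manifold \<Rightarrow> ('m, 'e) chart \<Rightarrow> 'e \<Rightarrow> 'e \<Rightarrow> 'e \<Rightarrow> 'e" where
  "christoffel M c u \<xi> \<eta> = (THE w. \<forall>\<zeta>. metric_coeff M c u w \<zeta> =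
     (frechet_derivative (\<lambda>u'. metric_coeff M c u' \<eta> \<zeta>) (at u) \<xi>
      + frechet_derivative (\<lambda>u'. metric_coeff M c u' \<xi> \<zeta>) (at u) \<eta>
      - frechet_derivative (\<lambda>u'. metric_coeff M c u' \<xi> \<eta>) (at u) \<zeta>) / 2)"

definition cov_deriv ::
  "('m, 'e::euclidean_space) manifold \<Rightarrow> (real \<Rightarrow> 'm) \<Rightarrow> (real \<Rightarrow> ('m, 'e) tvec) \<Rightarrow> real \<Rightarrow> ('m, 'e) tvec"
  where "cov_deriv M \<gamma> V t =
     (\<lambda>c. if c \<in> charts_at M (\<gamma> t)
          then vector_derivative (\<lambda>\<tau>. V \<tau> c) (at t)
               + christoffel M c (chart_map c (\<gamma> t)) (velocity M \<gamma> t c) (V t c)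
          else 0)"

text \<open>The Euclidean space \<open>(tspace M x, rmetric M x)\<close> is not a type; differentiability is
  expressed through the linear isomorphisms \<open>tlift M c x\<close> from the model space.\<close>

definition tgrad ::
  "('m, 'e::euclidean_space) manifold \<Rightarrow> 'm \<Rightarrow> (('m, 'e) tvec \<Rightarrow> real) \<Rightarrow> ('m, 'e) tvec \<Rightarrow> ('m, 'e) tvec"
  where "tgrad M x h s = (THE G. G \<in> tspace M x \<and>
     (\<forall>c\<in>charts_at M x.
        ((\<lambda>\<xi>. h (tlift M c x \<xi>)) has_derivative (\<lambda>\<eta>. rmetric M x G (tlift M c x \<eta>))) (at (s c))))"

definition thess ::
  "('m, 'e::euclidean_space) manifold \<Rightarrow> 'm \<Rightarrow> (('m, 'e) tvec \<Rightarrow> real) \<Rightarrow>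
   ('m, 'e) tvec \<Rightarrow> ('m, 'e) tvec \<Rightarrow> ('m, 'e) tvec"
  where "thess M x h s v =
     (\<lambda>c. if c \<in> charts_at M x
          then frechet_derivative (\<lambda>\<xi>. tgrad M x h (tlift M c x \<xi>) c) (at (s c)) (v c)
          else 0)"

definition lambda_min ::
  "('m, 'e::euclidean_space) manifold \<Rightarrow> 'm \<Rightarrow> (('m, 'e) tvec \<Rightarrow> ('m, 'e) tvec) \<Rightarrow> real"
  where "lambda_min M x H = Min {l. \<exists>v\<in>tspace M x. v \<noteq> 0 \<and> H v = l *\<^sub>R v}"

text \<open>The differential of \<open>R x\<close> at \<open>s\<close>, applied to a tangent vector \<open>w\<close>.\<close>

definition retr_diff ::
  "('m, 'e::euclidean_space) manifold \<Rightarrow> ('m \<Rightarrow> ('m, 'e) tvec \<Rightarrow> 'm) \<Rightarrow> 'm \<Rightarrow>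
   ('m, 'e) tvec \<Rightarrow> ('m, 'e) tvec \<Rightarrow> ('m, 'e) tvec"
  where "retr_diff M R x s w = velocity M (\<lambda>\<tau>. R x (s + \<tau> *\<^sub>R w)) 0"

text \<open>Smoothness on the tangent bundle is expressed in its standard charts
  \<open>(x, v) \<mapsto> (chart_map c x, v c)\<close>; openness of the sets \<open>W\<close> is continuity.\<close>

definition smooth_on_bundle ::
  "('m, 'e::euclidean_space) manifold \<Rightarrow> ('m \<Rightarrow> ('m, 'e) tvec \<Rightarrow> 'm) \<Rightarrow> bool"
  where "smooth_on_bundle M R \<longleftrightarrow>
     (\<forall>c\<in>atlas M. \<forall>d\<in>atlas M.
        let F = (\<lambda>(u, \<xi>). R (chart_inv c u) (tlift M c (chart_inv c u) \<xi>));
            W = {p \<in> chart_img c \<times> UNIV. F p \<in> chart_dom d}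
        in open W \<and> smooth_on W (chart_map d \<circ> F))"

definition retraction_on ::
  "('m, 'e::euclidean_space) manifold \<Rightarrow> ('m \<Rightarrow> ('m, 'e) tvec \<Rightarrow> 'm) \<Rightarrow> bool"
  where "retraction_on M R \<longleftrightarrow>
     (\<forall>x\<in>carrier M. \<forall>s\<in>tspace M x. R x s \<in> carrier M) \<and>
     smooth_on_bundle M R \<and>
     (\<forall>x\<in>carrier M. R x 0 = x \<and> (\<forall>w\<in>tspace M x. retr_diff M R x 0 w = w))"

definition second_order_nice ::
  "('m, 'e::euclidean_space) manifold \<Rightarrow> ('m \<Rightarrow> ('m, 'e) tvec \<Rightarrow> 'm) \<Rightarrow>
   ('m \<times> ('m, 'e) tvec) set \<Rightarrow> bool"
  where "second_order_nice M R S \<longleftrightarrow>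
     (\<exists>c1 c2 c3. \<forall>(x, s)\<in>S. \<forall>w\<in>tspace M x.
        (\<forall>t\<in>{0..1}. t_onorm M x (R x (t *\<^sub>R s)) (retr_diff M R x (t *\<^sub>R s)) \<le> c1) \<and>
        (\<forall>t\<in>{0..1}.
           tnorm M (R x (t *\<^sub>R s))
             (cov_deriv M (\<lambda>\<tau>. R x (\<tau> *\<^sub>R s)) (\<lambda>\<tau>. retr_diff M R x (\<tau> *\<^sub>R s) w) t)
           \<le> c2 * tnorm M x s * tnorm M x w) \<and>
        (let c = (\<lambda>\<tau>. R x (s + \<tau> *\<^sub>R w))
         in tnorm M (c 0) (cov_deriv M c (velocity M c) 0) \<le> c3 * tnorm M x s * (tnorm M x w)\<^sup>2))"

definition pullback :: "('m \<Rightarrow> ('m, 'e) tvec \<Rightarrow> 'm) \<Rightarrow> ('m \<Rightarrow> real) \<Rightarrow> 'm \<Rightarrow> ('m, 'e) tvec \<Rightarrow> real"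
  where "pullback R f x s = f (R x s)"

definition taylor2 ::
  "('m, 'e::euclidean_space) manifold \<Rightarrow> 'm \<Rightarrow> (('m, 'e) tvec \<Rightarrow> real) \<Rightarrow> ('m, 'e) tvec \<Rightarrow> real"
  where "taylor2 M x h s =
     h 0 + rmetric M x s (tgrad M x h 0) + 1/2 * rmetric M x s (thess M x h 0 s)"

definition arc_model ::
  "('m, 'e::euclidean_space) manifold \<Rightarrow> ('m \<Rightarrow> ('m, 'e) tvec \<Rightarrow> 'm) \<Rightarrow> ('m \<Rightarrow> real) \<Rightarrow>
   'm \<Rightarrow> real \<Rightarrow> ('m, 'e) tvec \<Rightarrow> real"
  where "arc_model M R f x \<sigma> s = taylor2 M x (pullback R f x) s + \<sigma> / 3 * tnorm M x s ^ 3"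

definition arc_ratio ::
  "('m, 'e::euclidean_space) manifold \<Rightarrow> ('m \<Rightarrow> ('m, 'e) tvec \<Rightarrow> 'm) \<Rightarrow> ('m \<Rightarrow> real) \<Rightarrow>
   'm \<Rightarrow> real \<Rightarrow> ('m, 'e) tvec \<Rightarrow> real"
  where "arc_ratio M R f x \<sigma> s =
     (f x - f (R x s)) /
     (arc_model M R f x \<sigma> 0 - arc_model M R f x \<sigma> s + \<sigma> / 3 * tnorm M x s ^ 3)"

text \<open>The flag \<open>so\<close> tells whether the subproblem solver also enforces the optional
  second-order condition.\<close>

definition arc_step ::
  "('m, 'e::euclidean_space) manifold \<Rightarrow> ('m \<Rightarrow> ('m, 'e) tvec \<Rightarrow> 'm) \<Rightarrow> ('m \<Rightarrow> real) \<Rightarrow>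
   bool \<Rightarrow> real \<Rightarrow> 'm \<Rightarrow> real \<Rightarrow> ('m, 'e) tvec \<Rightarrow> bool"
  where "arc_step M R f so \<theta> x \<sigma> s \<longleftrightarrow>
     (let m = arc_model M R f x \<sigma> in
        s \<in> tspace M x \<and> m s \<le> m 0 \<and>
        tnorm M x (tgrad M x m s) \<le> \<theta> * (tnorm M x s)\<^sup>2 \<and>
        (so \<longrightarrow> lambda_min M x (thess M x m s) \<ge> - \<theta> * tnorm M x s))"

text \<open>Sequences are total functions; iteration \<open>k\<close> is executed iff no earlier trial step vanished.
  Values at later indices are unconstrained. An executed iteration with \<open>s k = 0\<close> terminates
  the algorithm before any ratio is computed, and so is neither successful nor unsuccessful.\<close>

definition arc_executed :: "(nat \<Rightarrow> ('m, 'e::euclidean_space) tvec) \<Rightarrow> nat \<Rightarrow> bool"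
  where "arc_executed s k \<longleftrightarrow> (\<forall>j<k. s j \<noteq> 0)"

definition arc_successful ::
  "('m, 'e::euclidean_space) manifold \<Rightarrow> ('m \<Rightarrow> ('m, 'e) tvec \<Rightarrow> 'm) \<Rightarrow> ('m \<Rightarrow> real) \<Rightarrow>
   real \<Rightarrow> (nat \<Rightarrow> 'm) \<Rightarrow> (nat \<Rightarrow> ('m, 'e) tvec) \<Rightarrow> (nat \<Rightarrow> real) \<Rightarrow> nat \<Rightarrow> bool"
  where "arc_successful M R f \<eta>1 x s \<sigma> k \<longleftrightarrow>
     arc_executed s k \<and> s k \<noteq> 0 \<and> arc_ratio M R f (x k) (\<sigma> k) (s k) \<ge> \<eta>1"

definition arc_run ::
  "('m, 'e::euclidean_space) manifold \<Rightarrow> ('m \<Rightarrow> ('m, 'e) tvec \<Rightarrow> 'm) \<Rightarrow> ('m \<Rightarrow> real) \<Rightarrow>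
   bool \<Rightarrow> real \<Rightarrow> real \<Rightarrow> real \<Rightarrow> real \<Rightarrow> real \<Rightarrow> real \<Rightarrow> real \<Rightarrow>
   (nat \<Rightarrow> 'm) \<Rightarrow> (nat \<Rightarrow> ('m, 'e) tvec) \<Rightarrow> (nat \<Rightarrow> real) \<Rightarrow> bool"
  where "arc_run M R f so \<theta> \<sigma>min \<eta>1 \<eta>2 \<gamma>1 \<gamma>2 \<gamma>3 x s \<sigma> \<longleftrightarrow>
     x 0 \<in> carrier M \<and> \<sigma> 0 \<ge> \<sigma>min \<and>
     (\<forall>k. arc_executed s k \<longrightarrow>
        arc_step M R f so \<theta> (x k) (\<sigma> k) (s k) \<and>
        (s k \<noteq> 0 \<longrightarrow>
          (let \<rho> = arc_ratio M R f (x k) (\<sigma> k) (s k) in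
             x (Suc k) = (if \<rho> \<ge> \<eta>1 then R (x k) (s k) else x k) \<and>
             \<sigma> (Suc k) \<in>
               (if \<rho> \<ge> \<eta>2 then {max \<sigma>min (\<gamma>1 * \<sigma> k)..\<sigma> k}
                else if \<rho> \<ge> \<eta>1 then {\<sigma> k..\<gamma>2 * \<sigma> k}
                else {\<gamma>2 * \<sigma> k..\<gamma>3 * \<sigma> k}))))"

definition iterates_in_compact ::
  "('m, 'e::euclidean_space) manifold \<Rightarrow> (nat \<Rightarrow> 'm) \<Rightarrow> (nat \<Rightarrow> ('m, 'e) tvec) \<Rightarrow> bool"
  where "iterates_in_compact M x s \<longleftrightarrow>
     (\<exists>K. compactin (mtop M) K \<and> (\<forall>k. arc_executed s k \<longrightarrow> x k \<in> K))"

end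

theory Submission
  imports Defs
begin

text \<open>
  Written in a chart, the pullback is a jointly \<open>C\<^sup>3\<close> function \<open>F (u, \<xi>)\<close> of the base point and the
  tangent coordinates. On a compact set of base points its first two derivatives at \<open>\<xi> = 0\<close> are
  bounded and the metric is bounded below, so \<open>m\<^sub>k(s\<^sub>k) \<le> m\<^sub>k(0)\<close> together with
  \<open>\<sigma>\<^sub>k \<ge> \<sigma>\<^sub>m\<^sub>i\<^sub>n > 0\<close> forces the trial steps to be uniformly bounded: the cubic term would otherwise
  dominate. Hence all segments from \<open>0\<close> to \<open>s\<^sub>k\<close> lie in a compact part of the tangent bundle, where
  the third derivative of \<open>F\<close> is bounded, and both estimates are Taylor's theorem along these
  segments.
\<close>

subsection \<open>Calculus of iterated directional derivatives\<close>

text \<open>Tangent vectors at different base points belong to different function sets, so uniform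
  constants are sought in a chart, where all tangent spaces become the model space and uniformity in
  the base point is compactness in a product. A compact set of iterates need not fit into one chart;
  hence the constants are found near each point and combined over a finite subcover.

  What is localised mentions no sequence: it concerns every base point \<open>y\<close>, every
  \<sigma> \<ge> \<open>\<sigma>min\<close> and every tangent vector that does not increase the
  model. A large \<sigma> does no harm, since it only sharpens what the decrease says about the
  length of the step.

  The gradient estimate concerns the norm of a vector. Pairing the error vector with itself turns
  the squared norm into the scalar Taylor remainder of a first directional derivative, and one
  factor of the norm cancels. Both estimates then rest on the same bound for third derivatives and
  on the same comparison of coordinate norm and Riemannian norm.\<close>

abbreviation ddir :: "'a::real_normed_vector \<Rightarrow> ('a \<Rightarrow> 'b::real_normed_vector) \<Rightarrow> 'a \<Rightarrow> 'b"
  where "ddir v f \<equiv> (\<lambda>x. frechet_derivative f (at x) v)"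

text \<open>\<open>frechet_derivative\<close> is a choice among all derivatives, so equal sets of
  candidates give equal values, even where neither function is differentiable.\<close>

lemma frechet_derivative_cong_open:
  assumes "open S" "x \<in> S" "\<And>y. y \<in> S \<Longrightarrow> f y = g y"
  shows "frechet_derivative f (at x) = frechet_derivative g (at x)"
proof -
  have "(f has_derivative D) (at x) \<longleftrightarrow> (g has_derivative D) (at x)" for D
    using assms by (auto elim: has_derivative_transform_within_open)
  then show ?thesis unfolding frechet_derivative_def by simp
qed

text \<open>Differentiation rules give formulas only at points of \<open>S\<close>; this lets such a
  formula stand in for \<open>frechet_derivative\<close>, whose behaviour outside \<open>S\<close>
  is unknown.\<close>

lemma Ck_on_cong:
  assumes "open S" "\<And>x. x \<in> S \<Longrightarrow> f x = g x" "Ck_on n S f"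
  shows "Ck_on n S g"
  using assms
proof (induction n arbitrary: f g)
  case 0
  then show ?case by (auto cong: continuous_on_cong)
next
  case (Suc n)
  have "f differentiable (at x) \<longleftrightarrow> g differentiable (at x)" if "x \<in> S" for x
    using Suc.prems(1,2) that unfolding differentiable_def
    by (metis has_derivative_transform_within_open)
  moreover have "Ck_on n S (ddir v g)" for v
    by (rule Suc.IH[of "ddir v f"])
      (use Suc.prems frechet_derivative_cong_open[of S _ f g] in auto)
  ultimately show ?case using Suc.prems(3) by simp
qed

lemma Ck_on_SucD: "Ck_on (Suc n) S f \<Longrightarrow> Ck_on n S f"
proof (induction n arbitrary: f)
  case 0
  then show ?case
    by (auto intro!: continuous_at_imp_continuous_on differentiable_imp_continuous_within)
next
  case (Suc n)
  then show ?case by (metis Ck_on.simps(2))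
qed

lemma Ck_on_le:
  assumes "Ck_on n S f" "k \<le> n"
  shows "Ck_on k S f"
  using assms(2,1) by (induction rule: inc_induct) (blast intro: Ck_on_SucD)+

text \<open>Regularity is local. This glues the pullback over the preimages of the target
  charts.\<close>

lemma Ck_on_UN:
  assumes "\<And>i. i \<in> I \<Longrightarrow> open (S i)" "\<And>i. i \<in> I \<Longrightarrow> Ck_on n (S i) f"
  shows "Ck_on n (\<Union>i\<in>I. S i) f"
  using assms(2) by (induction n arbitrary: f) (auto intro: continuous_on_open_UN assms(1))

lemma Ck_on_const: "Ck_on n S (\<lambda>x. c)"
  by (induction n arbitrary: c) auto

lemma Ck_on_add:
  assumes "open S" "Ck_on n S f" "Ck_on n S g"
  shows "Ck_on n S (\<lambda>x. f x + g x)"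
  using assms(2,3)
proof (induction n arbitrary: f g)
  case 0
  then show ?case by (auto intro: continuous_intros)
next
  case (Suc n)
  have der: "((\<lambda>x. f x + g x) has_derivative (\<lambda>v. ddir v f x + ddir v g x)) (at x)" if "x \<in> S" for x
    using Suc.prems that by (auto intro!: derivative_eq_intros simp: frechet_derivative_works[symmetric])
  have "Ck_on n S (ddir v (\<lambda>x. f x + g x))" for v
    by (rule Ck_on_cong[OF assms(1), of "\<lambda>x. ddir v f x + ddir v g x"])
      (use Suc frechet_derivative_at[OF der] in \<open>auto dest: fun_cong\<close>)
  then show ?case using Suc.prems by auto
qed

lemma Ck_on_sum:
  assumes "open S" "\<And>i. i \<in> I \<Longrightarrow> Ck_on n S (f i)"
  shows "Ck_on n S (\<lambda>x. \<Sum>i\<in>I. f i x)"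
  using assms(2)
  by (induction I rule: infinite_finite_induct) (auto intro: Ck_on_const Ck_on_add assms(1))

lemma Ck_on_inner:
  assumes "open S" "Ck_on n S f"
  shows "Ck_on n S (\<lambda>x. f x \<bullet> c)"
  using assms(2)
proof (induction n arbitrary: f)
  case 0
  then show ?case by (auto intro: continuous_intros)
next
  case (Suc n)
  have der: "((\<lambda>x. f x \<bullet> c) has_derivative (\<lambda>v. ddir v f x \<bullet> c)) (at x)" if "x \<in> S" for x
    using Suc.prems that by (auto intro!: derivative_eq_intros simp: frechet_derivative_works[symmetric])
  have "Ck_on n S (ddir v (\<lambda>x. f x \<bullet> c))" for v
    by (rule Ck_on_cong[OF assms(1), of "\<lambda>x. ddir v f x \<bullet> c"])
      (use Suc frechet_derivative_at[OF der] in \<open>auto dest: fun_cong\<close>)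
  then show ?case using der by (auto simp: differentiable_def)
qed

lemma Ck_on_scaleR:
  fixes g :: "'a::euclidean_space \<Rightarrow> real" and f :: "'a \<Rightarrow> 'b::real_normed_vector"
  assumes "open S" "Ck_on n S f" "Ck_on n S g"
  shows "Ck_on n S (\<lambda>x. g x *\<^sub>R f x)"
  using assms(2,3)
proof (induction n arbitrary: f g)
  case 0
  then show ?case by (auto intro: continuous_intros)
next
  case (Suc n)
  have der: "((\<lambda>x. g x *\<^sub>R f x) has_derivative (\<lambda>v. g x *\<^sub>R ddir v f x + ddir v g x *\<^sub>R f x)) (at x)"
    if "x \<in> S" for x
    using Suc.prems that by (auto intro!: derivative_eq_intros simp: frechet_derivative_works[symmetric])
  have "Ck_on n S (ddir v (\<lambda>x. g x *\<^sub>R f x))" for v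
  proof (rule Ck_on_cong[OF assms(1), of "\<lambda>x. g x *\<^sub>R ddir v f x + ddir v g x *\<^sub>R f x"])
    show "Ck_on n S (\<lambda>x. g x *\<^sub>R ddir v f x + ddir v g x *\<^sub>R f x)"
      using Suc.prems Ck_on_SucD[OF Suc.prems(1)] Ck_on_SucD[OF Suc.prems(2)]
      by (intro Ck_on_add Suc.IH assms(1)) auto
  qed (use frechet_derivative_at[OF der] in \<open>auto dest: fun_cong\<close>)
  then show ?case using der by (auto simp: differentiable_def)
qed

text \<open>\<open>Ck_on\<close> controls derivatives of \<open>g\<close> in fixed directions only,
  whereas the chain rule differentiates \<open>g\<close> in the moving direction
  \<open>ddir v h x\<close>. Expanding that direction in the basis leaves products of coordinates of
  \<open>ddir v h\<close> with partial derivatives of \<open>g\<close> composed with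
  \<open>h\<close>, to which the induction hypothesis applies.\<close>

lemma Ck_on_compose:
  fixes g :: "'b::euclidean_space \<Rightarrow> 'c::real_normed_vector" and h :: "'a::euclidean_space \<Rightarrow> 'b"
  assumes "open S" "open T" "h ` S \<subseteq> T" "Ck_on n T g" "Ck_on n S h"
  shows "Ck_on n S (g \<circ> h)"
  using assms(4,5)
proof (induction n arbitrary: g)
  case 0
  then show ?case using assms(3) by (metis Ck_on.simps(1) continuous_on_compose continuous_on_subset)
next
  case (Suc n)
  have diff: "g differentiable (at (h x))" "h differentiable (at x)" if "x \<in> S" for x
    using Suc.prems assms(3) that by auto
  have dd: "ddir v (g \<circ> h) x = (\<Sum>i\<in>Basis. (ddir v h x \<bullet> i) *\<^sub>R (ddir i g \<circ> h) x)" if "x \<in> S" for x v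
  proof -
    have "linear (frechet_derivative g (at (h x)))"
      using diff[OF that] by (simp add: linear_frechet_derivative)
    have "ddir v (g \<circ> h) x = frechet_derivative g (at (h x)) (ddir v h x)"
      using frechet_derivative_compose[OF diff(2)[OF that] diff(1)[OF that]] by simp
    also have "\<dots> = frechet_derivative g (at (h x)) (\<Sum>i\<in>Basis. (ddir v h x \<bullet> i) *\<^sub>R i)"
      by (simp add: euclidean_representation)
    also have "\<dots> = (\<Sum>i\<in>Basis. (ddir v h x \<bullet> i) *\<^sub>R (ddir i g \<circ> h) x)"
      using \<open>linear _\<close> by (simp add: linear_sum linear_cmul)
    finally show ?thesis .
  qed
  have "Ck_on n S (ddir v (g \<circ> h))" for v
  proof (rule Ck_on_cong[OF assms(1) dd[symmetric]])
    show "Ck_on n S (\<lambda>x. \<Sum>i\<in>Basis. (ddir v h x \<bullet> i) *\<^sub>R (ddir i g \<circ> h) x)"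
      using Suc.prems Ck_on_SucD[OF Suc.prems(2)]
      by (intro Ck_on_sum Ck_on_scaleR Ck_on_inner assms(1) Suc.IH) auto
  qed
  moreover have "(g \<circ> h) differentiable (at x)" if "x \<in> S" for x
    using differentiable_chain_at[OF diff(2)[OF that] diff(1)[OF that]] .
  ultimately show ?case unfolding Ck_on.simps by blast
qed

section \<open>Higher derivatives as multilinear forms on lists of directions, bounded on compact
  sets\<close>

primrec dir_derivs :: "'a list \<Rightarrow> ('a::real_normed_vector \<Rightarrow> 'b::real_normed_vector) \<Rightarrow> 'a \<Rightarrow> 'b" where
  "dir_derivs [] f = f"
| "dir_derivs (v # vs) f = dir_derivs vs (ddir v f)"

lemma dir_derivs_cong:
  assumes "open S" "\<And>y. y \<in> S \<Longrightarrow> f y = g y" "x \<in> S"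
  shows "dir_derivs vs f x = dir_derivs vs g x"
  using assms(2,3)
proof (induction vs arbitrary: f g x)
  case (Cons v vs)
  have "ddir v f y = ddir v g y" if "y \<in> S" for y
    using frechet_derivative_cong_open[OF assms(1) that, of f g] Cons.prems(1) by simp
  from Cons.IH[OF this Cons.prems(2)] show ?case by simp
qed simp

lemma dir_derivs_sum:
  fixes f :: "'i \<Rightarrow> 'a::euclidean_space \<Rightarrow> 'b::real_normed_vector"
  assumes "open S" "\<And>i. i \<in> I \<Longrightarrow> Ck_on (length vs) S (f i)" "x \<in> S"
  shows "dir_derivs vs (\<lambda>y. \<Sum>i\<in>I. a i *\<^sub>R f i y) x = (\<Sum>i\<in>I. a i *\<^sub>R dir_derivs vs (f i) x)"
  using assms(2,3)
proof (induction vs arbitrary: f x)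
  case (Cons v vs)
  have "ddir v (\<lambda>y. \<Sum>i\<in>I. a i *\<^sub>R f i y) y = (\<Sum>i\<in>I. a i *\<^sub>R ddir v (f i) y)" if "y \<in> S" for y
  proof -
    have "((\<lambda>y. \<Sum>i\<in>I. a i *\<^sub>R f i y) has_derivative (\<lambda>v. \<Sum>i\<in>I. a i *\<^sub>R ddir v (f i) y)) (at y)"
      using Cons.prems(1) that
      by (intro has_derivative_sum has_derivative_scaleR_right)
        (simp add: frechet_derivative_works[symmetric])
    from fun_cong[OF frechet_derivative_at[OF this], of v] show ?thesis by simp
  qed
  then have "dir_derivs (v # vs) (\<lambda>y. \<Sum>i\<in>I. a i *\<^sub>R f i y) x
      = dir_derivs vs (\<lambda>y. \<Sum>i\<in>I. a i *\<^sub>R ddir v (f i) y) x"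
    by (subst dir_derivs.simps, intro dir_derivs_cong[OF assms(1) _ Cons.prems(2)])
  also have "\<dots> = (\<Sum>i\<in>I. a i *\<^sub>R dir_derivs vs (ddir v (f i)) x)"
    by (rule Cons.IH) (use Cons.prems in auto)
  finally show ?case by simp
qed simp

text \<open>Compactness bounds a derivative only for each fixed list of directions. Expanding every
  direction in the basis reduces all lists to finitely many, and the coefficients are at most the
  norms of the directions.\<close>

lemma dir_derivs_bound:
  fixes f :: "'a::euclidean_space \<Rightarrow> 'b::real_normed_vector"
  assumes "open S" "compact K" "K \<subseteq> S" "Ck_on n S f"
  shows "\<exists>C\<ge>0. \<forall>x\<in>K. \<forall>vs. length vs = n \<longrightarrow> norm (dir_derivs vs f x) \<le> C * (\<Prod>v\<leftarrow>vs. norm v)"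
  using assms(4)
proof (induction n arbitrary: f)
  case 0
  then have "bounded (f ` K)"
    using assms(2,3) by (auto intro: compact_imp_bounded compact_continuous_image continuous_on_subset)
  then obtain C where "\<forall>x\<in>K. norm (f x) \<le> C" by (auto simp: bounded_iff)
  \<comment> \<open>For an empty \<open>K\<close> the bound \<open>C\<close> may be
    negative.\<close>
  then show ?case by (intro exI[of _ "max 0 C"]) (auto simp: le_max_iff_disj)
next
  case (Suc n)
  have "\<exists>C\<ge>0. \<forall>x\<in>K. \<forall>vs. length vs = n \<longrightarrow> norm (dir_derivs vs (ddir i f) x) \<le> C * (\<Prod>v\<leftarrow>vs. norm v)" for i
    by (rule Suc.IH) (use Suc.prems in auto)
  then obtain C where C: "\<And>i. C i \<ge> 0"
    "\<And>i x vs. x \<in> K \<Longrightarrow> length vs = n \<Longrightarrow> norm (dir_derivs vs (ddir i f) x) \<le> C i * (\<Prod>v\<leftarrow>vs. norm v)"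
    by metis
  have "norm (dir_derivs (v # vs) f x) \<le> sum C Basis * (\<Prod>v\<leftarrow>(v # vs). norm v)"
    if "x \<in> K" "length vs = n" for x v vs
  proof -
    have "ddir v f y = (\<Sum>i\<in>Basis. (v \<bullet> i) *\<^sub>R ddir i f y)" if "y \<in> S" for y
    proof -
      have "linear (frechet_derivative f (at y))"
        using Suc.prems that by (simp add: linear_frechet_derivative)
      then have "frechet_derivative f (at y) (\<Sum>i\<in>Basis. (v \<bullet> i) *\<^sub>R i) = (\<Sum>i\<in>Basis. (v \<bullet> i) *\<^sub>R ddir i f y)"
        by (simp add: linear_sum linear_cmul)
      then show ?thesis by (simp add: euclidean_representation)
    qed
    then have "dir_derivs (v # vs) f x = dir_derivs vs (\<lambda>y. \<Sum>i\<in>Basis. (v \<bullet> i) *\<^sub>R ddir i f y) x"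
      by (subst dir_derivs.simps, intro dir_derivs_cong[OF assms(1)]) (use that(1) assms(3) in auto)
    also have "\<dots> = (\<Sum>i\<in>Basis. (v \<bullet> i) *\<^sub>R dir_derivs vs (ddir i f) x)"
      by (rule dir_derivs_sum[OF assms(1)]) (use that assms(3) Suc.prems in auto)
    also have "norm \<dots> \<le> (\<Sum>i\<in>Basis. norm v * (C i * (\<Prod>v\<leftarrow>vs. norm v)))"
      using C that by (intro sum_norm_le) (auto intro!: mult_mono Basis_le_norm)
    also have "\<dots> = sum C Basis * (\<Prod>v\<leftarrow>(v # vs). norm v)"
      by (simp add: sum_distrib_left sum_distrib_right mult_ac)
    finally show ?thesis .
  qed
  then show ?case using C(1) by (intro exI[of _ "sum C Basis"]) (auto simp: length_Suc_conv sum_nonneg)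
qed

section \<open>Taylor expansion along a segment\<close>

lemma Ck_on_has_derivative:
  "Ck_on (Suc n) S f \<Longrightarrow> x \<in> S \<Longrightarrow> (f has_derivative (\<lambda>v. ddir v f x)) (at x)"
  by (simp add: frechet_derivative_works[symmetric])

lemma Ck_on_line_derivative:
  assumes "Ck_on (Suc n) S f" "p + t *\<^sub>R v \<in> S"
  shows "((\<lambda>\<tau>. f (p + \<tau> *\<^sub>R v)) has_vector_derivative ddir v f (p + t *\<^sub>R v)) (at t)"
proof -
  have line: "((\<lambda>\<tau>. p + \<tau> *\<^sub>R v) has_vector_derivative v) (at t)"
    by (auto intro!: derivative_eq_intros)
  show ?thesis
    using vector_derivative_diff_chain_within[OF line has_derivative_at_withinI[OF Ck_on_has_derivative[OF assms]]]
    by (simp add: o_def)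
qed

text \<open>Lagrange form of the remainder at 1. It serves with \<open>n = 3\<close> for the value
  of the pullback and with \<open>n = 2\<close> for its gradient.\<close>

lemma taylor_remainder_bound:
  fixes d :: "nat \<Rightarrow> real \<Rightarrow> real"
  assumes n: "n > 0"
    and d: "\<And>m t. m < n \<Longrightarrow> 0 \<le> t \<Longrightarrow> t \<le> 1 \<Longrightarrow> (d m has_real_derivative d (Suc m) t) (at t)"
    and b: "\<And>t. 0 \<le> t \<Longrightarrow> t \<le> 1 \<Longrightarrow> \<bar>d n t\<bar> \<le> B"
  shows "\<bar>d 0 1 - (\<Sum>m<n. d m 0 / fact m)\<bar> \<le> B / fact n"
proof -
  obtain t where t: "0 < t" "t \<le> 1"
    and eq: "d 0 1 = (\<Sum>m<n. d m 0 / fact m * 1 ^ m) + d n t / fact n * 1 ^ n"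
    using Maclaurin2[of 1 d "d 0" n] d by auto
  have "\<bar>d 0 1 - (\<Sum>m<n. d m 0 / fact m)\<bar> = \<bar>d n t\<bar> / fact n"
    using eq by simp
  also have "\<dots> \<le> B / fact n" using b[of t] t by (intro divide_right_mono) auto
  finally show ?thesis .
qed

text \<open>The head of the list is the innermost derivative, so directions appended at the end are
  taken last.\<close>

lemma dir_derivs_append: "dir_derivs (vs @ ws) f = dir_derivs ws (dir_derivs vs f)"
  by (induction vs arbitrary: f) auto

lemma Ck_on_dir_derivs: "Ck_on (length vs + k) S f \<Longrightarrow> Ck_on k S (dir_derivs vs f)"
  by (induction vs arbitrary: f) auto

lemma taylor_line_bound:
  fixes \<phi> :: "'a::euclidean_space \<Rightarrow> real"
  assumes "Ck_on n S \<phi>" "n > 0" "\<And>t. 0 \<le> t \<Longrightarrow> t \<le> 1 \<Longrightarrow> t *\<^sub>R \<xi> \<in> S"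
    and "\<And>t. 0 \<le> t \<Longrightarrow> t \<le> 1 \<Longrightarrow> \<bar>dir_derivs (replicate n \<xi>) \<phi> (t *\<^sub>R \<xi>)\<bar> \<le> B"
  shows "\<bar>\<phi> \<xi> - (\<Sum>m<n. dir_derivs (replicate m \<xi>) \<phi> 0 / fact m)\<bar> \<le> B / fact n"
proof -
  define d where "d m t = dir_derivs (replicate m \<xi>) \<phi> (t *\<^sub>R \<xi>)" for m t
  have "(d m has_real_derivative d (Suc m) t) (at t)" if "m < n" "0 \<le> t" "t \<le> 1" for m t
  proof -
    have "Ck_on (length (replicate m \<xi>) + Suc (n - Suc m)) S \<phi>"
      using assms(1) that by simp
    then have "Ck_on (Suc (n - Suc m)) S (dir_derivs (replicate m \<xi>) \<phi>)"
      by (rule Ck_on_dir_derivs)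
    \<comment> \<open>Differentiating in \<open>t\<close> adds an outermost derivative, so the new
      copy of \<xi> has to be moved from the head of the list to its end.\<close>
    from Ck_on_line_derivative[OF this, of 0 t \<xi>] that assms(3)
    show ?thesis
      unfolding d_def has_real_derivative_iff_has_vector_derivative
        replicate_Suc replicate_append_same[symmetric] dir_derivs_append
      by simp
  qed
  from taylor_remainder_bound[of n d B, OF assms(2) this] assms(4)
  show ?thesis by (simp add: d_def)
qed

text \<open>Derivatives along a fibre are derivatives of \<open>F\<close> in vertical directions. A
  bound for \<open>F\<close> on a compact subset of the product therefore gives bounds on the fibres
  that are uniform in \<open>u\<close>.\<close>

lemma dir_derivs_section:
  fixes F :: "'a::euclidean_space \<times> 'b::euclidean_space \<Rightarrow> 'c::real_normed_vector"
  assumes "open U" "Ck_on (length vs) (U \<times> UNIV) F" "u \<in> U"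
  shows "dir_derivs vs (\<lambda>\<xi>. F (u, \<xi>)) \<xi> = dir_derivs (map (Pair 0) vs) F (u, \<xi>)"
  using assms(2)
proof (induction vs arbitrary: F)
  case (Cons v vs)
  have "ddir v (\<lambda>\<xi>. F (u, \<xi>)) = (\<lambda>\<xi>. ddir (0, v) F (u, \<xi>))"
  proof
    fix \<xi>
    have "((\<lambda>\<xi>. F (u, \<xi>)) has_derivative (\<lambda>v. ddir (0, v) F (u, \<xi>))) (at \<xi>)"
    proof -
      have "(F has_derivative (\<lambda>v. ddir v F (u, \<xi>))) (at (u, \<xi>))"
        by (rule Ck_on_has_derivative[of "length vs" "U \<times> UNIV"]) (use Cons.prems assms(3) in simp_all)
      moreover have "(Pair u has_derivative (\<lambda>v. (0, v))) (at \<xi>)"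
        by (auto intro!: derivative_eq_intros)
      ultimately show ?thesis
        using diff_chain_at[of "Pair u" "\<lambda>v. (0, v)" \<xi> F] by (simp add: o_def)
    qed
    from fun_cong[OF frechet_derivative_at[OF this], of v]
    show "ddir v (\<lambda>\<xi>. F (u, \<xi>)) \<xi> = ddir (0, v) F (u, \<xi>)" by simp
  qed
  then show ?case using Cons.IH[of "ddir (0, v) F"] Cons.prems by simp
qed simp

lemma Ck_on_section:
  fixes F :: "'a::euclidean_space \<times> 'b::euclidean_space \<Rightarrow> 'c::real_normed_vector"
  assumes "open U" "Ck_on n (U \<times> UNIV) F" "u \<in> U"
  shows "Ck_on n UNIV (\<lambda>\<xi>. F (u, \<xi>))"
proof -
  have P: "Ck_on n UNIV (Pair u :: 'b \<Rightarrow> 'a \<times> 'b)"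
  proof (cases n)
    case (Suc k)
    have der: "((Pair u :: 'b \<Rightarrow> 'a \<times> 'b) has_derivative (\<lambda>v. (0, v))) (at \<xi>)" for \<xi>
      by (auto intro!: derivative_eq_intros)
    have "ddir v (Pair u :: 'b \<Rightarrow> 'a \<times> 'b) = (\<lambda>\<xi>. (0, v))" for v
      using frechet_derivative_at[OF der] by (auto dest: fun_cong)
    then show ?thesis using Suc der by (auto simp: differentiable_def Ck_on_const)
  qed (auto intro: continuous_intros)
  have "Ck_on n UNIV (F \<circ> Pair u)"
    by (rule Ck_on_compose[OF open_UNIV _ _ assms(2) P]) (use assms in \<open>auto intro: open_Times\<close>)
  then show ?thesis by (simp add: o_def)
qed

subsection \<open>Charts and tangent spaces\<close>

lemma chart_map_inv: "u \<in> chart_img c \<Longrightarrow> chart_map c (chart_inv c u) = u"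
  and chart_inv_dom: "u \<in> chart_img c \<Longrightarrow> chart_inv c u \<in> chart_dom c"
  unfolding chart_inv_def chart_img_def by (auto simp: f_inv_into_f inv_into_into)

context
  fixes M :: "('m, 'e::euclidean_space) manifold"
  assumes sm: "smooth_manifold M"
begin

lemma chart_homeo:
  assumes "c \<in> atlas M"
  shows "homeomorphic_map (subtopology (mtop M) (chart_dom c)) (top_of_set (chart_img c)) (chart_map c)"
    and "openin (mtop M) (chart_dom c)" and "open (chart_img c)"
    and "topspace (subtopology (mtop M) (chart_dom c)) = chart_dom c"
  using sm assms openin_subset[of "mtop M" "chart_dom c"] unfolding smooth_manifold_def by auto

lemma chart_dom_carrier: "c \<in> atlas M \<Longrightarrow> y \<in> chart_dom c \<Longrightarrow> y \<in> carrier M"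
  using chart_homeo(2)[of c] openin_subset unfolding carrier_def by blast

lemma charts_at_nonempty: "y \<in> carrier M \<Longrightarrow> \<exists>c. c \<in> charts_at M y"
  using sm unfolding smooth_manifold_def charts_at_def by blast

lemma chart_inv_map:
  assumes "c \<in> atlas M" "y \<in> chart_dom c"
  shows "chart_inv c (chart_map c y) = y"
  using homeomorphic_imp_injective_map[OF chart_homeo(1)[OF assms(1)]] assms chart_homeo(4)[of c]
  unfolding chart_inv_def by (simp add: inv_into_f_f)

text \<open>Makes the domain of a transition map open, so that identities valid there pass to
  derivatives.\<close>

lemma chart_map_open:
  assumes "c \<in> atlas M" "openin (mtop M) U"
  shows "open (chart_map c ` (chart_dom c \<inter> U))"
proof -
  have "openin (subtopology (mtop M) (chart_dom c)) (chart_dom c \<inter> U)"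
    using assms(2) by (auto simp: openin_subtopology_Int2)
  then have "openin (top_of_set (chart_img c)) (chart_map c ` (chart_dom c \<inter> U))"
    using homeomorphic_imp_open_map[OF chart_homeo(1)[OF assms(1)]] unfolding open_map_def by blast
  then show ?thesis using chart_homeo(3)[OF assms(1)] openin_open_trans by (metis openin_open_eq)
qed

lemma chart_preimage_open:
  assumes "c \<in> atlas M" "open V"
  shows "openin (mtop M) {y \<in> chart_dom c. chart_map c y \<in> V}"
proof -
  have "openin (subtopology (mtop M) (chart_dom c))
      {y \<in> topspace (subtopology (mtop M) (chart_dom c)). chart_map c y \<in> chart_img c \<inter> V}"
    using homeomorphic_imp_continuous_map[OF chart_homeo(1)[OF assms(1)]] assms(2)
    by (intro openin_continuous_map_preimage) (auto intro: openin_open_Int)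
  moreover have "{y \<in> topspace (subtopology (mtop M) (chart_dom c)). chart_map c y \<in> chart_img c \<inter> V}
      = {y \<in> chart_dom c. chart_map c y \<in> V}"
    unfolding chart_homeo(4)[OF assms(1)] chart_img_def by auto
  ultimately show ?thesis
    using chart_homeo(2)[OF assms(1)] by (metis openin_trans_full)
qed

lemma transition_has_derivative:
  assumes "c \<in> charts_at M y" "d \<in> charts_at M y"
  shows "(chart_map d \<circ> chart_inv c has_derivative transition_deriv c d y) (at (chart_map c y))"
proof -
  have "smooth_on (chart_map c ` (chart_dom c \<inter> chart_dom d)) (chart_map d \<circ> chart_inv c)"
    using sm assms unfolding smooth_manifold_def charts_at_def by blast
  then have "Ck_on (Suc 0) (chart_map c ` (chart_dom c \<inter> chart_dom d)) (chart_map d \<circ> chart_inv c)"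
    unfolding smooth_on_def by blast
  from Ck_on_has_derivative[OF this, of "chart_map c y"] assms
  show ?thesis unfolding transition_deriv_def charts_at_def by auto
qed

lemma transition_linear:
  "c \<in> charts_at M y \<Longrightarrow> d \<in> charts_at M y \<Longrightarrow> bounded_linear (transition_deriv c d y)"
  using transition_has_derivative has_derivative_bounded_linear by blast

text \<open>Cocycle identity: the chain rule on the image of the overlap of \<open>c\<close> and
  \<open>d\<close>, where the chart \<open>d\<close> cancels. It is the reason why
  \<open>tlift\<close> produces tangent vectors.\<close>

lemma transition_compose:
  assumes "c \<in> charts_at M y" "d \<in> charts_at M y" "e \<in> charts_at M y"
  shows "transition_deriv d e y (transition_deriv c d y \<xi>) = transition_deriv c e y \<xi>"
proof -
  have at: "c \<in> atlas M" "d \<in> atlas M" "e \<in> atlas M" "y \<in> chart_dom c" "y \<in> chart_dom d" "y \<in> chart_dom e"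
    using assms by (auto simp: charts_at_def)
  have "((chart_map e \<circ> chart_inv d) \<circ> (chart_map d \<circ> chart_inv c) has_derivative
      transition_deriv d e y \<circ> transition_deriv c d y) (at (chart_map c y))"
    by (rule diff_chain_at[OF transition_has_derivative[OF assms(1,2)]])
      (use at transition_has_derivative[OF assms(2,3)] in \<open>simp add: chart_inv_map\<close>)
  then have "(chart_map e \<circ> chart_inv c has_derivative
      transition_deriv d e y \<circ> transition_deriv c d y) (at (chart_map c y))"
    by (rule has_derivative_transform_within_open[OF _ chart_map_open[OF at(1) chart_homeo(2)[OF at(2)]]])
      (use at in \<open>auto simp: chart_inv_map\<close>)
  from has_derivative_unique[OF this transition_has_derivative[OF assms(1,3)]]
  show ?thesis by (auto simp: fun_eq_iff)
qed

lemma transition_self: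
  assumes "c \<in> charts_at M y"
  shows "transition_deriv c c y \<xi> = \<xi>"
proof -
  have at: "c \<in> atlas M" "y \<in> chart_dom c" using assms by (auto simp: charts_at_def)
  have "(id has_derivative transition_deriv c c y) (at (chart_map c y))"
    by (rule has_derivative_transform_within_open[OF transition_has_derivative[OF assms assms]
          chart_homeo(3)[OF at(1)]])
      (use at in \<open>auto simp: chart_map_inv chart_img_def\<close>)
  from has_derivative_unique[OF this has_derivative_id] show ?thesis by (simp add: fun_eq_iff id_def)
qed

lemma tspace_transition:
  "v \<in> tspace M y \<Longrightarrow> c \<in> charts_at M y \<Longrightarrow> d \<in> charts_at M y \<Longrightarrow> transition_deriv c d y (v c) = v d"
  unfolding tspace_def mem_Collect_eq by metis

lemma tlift_tspace: "c \<in> charts_at M y \<Longrightarrow> tlift M c y \<xi> \<in> tspace M y"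
  unfolding tspace_def tlift_def by (auto simp: transition_compose)

lemma tlift_apply: "c \<in> charts_at M y \<Longrightarrow> tlift M c y \<xi> c = \<xi>"
  unfolding tlift_def by (auto simp: transition_self)

lemma tlift_coord: "c \<in> charts_at M y \<Longrightarrow> v \<in> tspace M y \<Longrightarrow> tlift M c y (v c) = v"
  unfolding tspace_def tlift_def fun_eq_iff mem_Collect_eq by metis

lemma tlift_transition:
  "c \<in> charts_at M y \<Longrightarrow> d \<in> charts_at M y \<Longrightarrow> tlift M d y (transition_deriv c d y \<xi>) = tlift M c y \<xi>"
  unfolding tlift_def fun_eq_iff by (auto simp: transition_compose)

lemma linear_tlift:
  assumes "c \<in> charts_at M y"
  shows "linear (tlift M c y)"
proof -
  have "linear (transition_deriv c d y)" if "d \<in> charts_at M y" for d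
    using transition_linear[OF assms that] by (rule bounded_linear.linear)
  then show ?thesis
    by (intro linearI) (auto simp: tlift_def fun_eq_iff scaleR_fun_def linear_add linear_cmul)
qed

lemma subspace_tspace: "subspace (tspace M y)"
proof -
  have lin: "linear (transition_deriv c d y)" if "c \<in> charts_at M y" "d \<in> charts_at M y" for c d
    using transition_linear[OF that] by (rule bounded_linear.linear)
  have D: "v d = transition_deriv c d y (v c)"
    if "v \<in> tspace M y" "c \<in> charts_at M y" "d \<in> charts_at M y" for v c d
    using that unfolding tspace_def by blast
  have Z: "c \<notin> charts_at M y \<Longrightarrow> v c = 0" if "v \<in> tspace M y" for v c
    using that unfolding tspace_def by blast
  show ?thesis
  proof (intro subspaceI)
    show "0 \<in> tspace M y"
      unfolding tspace_def by (auto simp: linear_0[OF lin])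
  next
    fix v w assume v: "v \<in> tspace M y" "w \<in> tspace M y"
    have "(v + w) d = transition_deriv c d y ((v + w) c)"
      if "c \<in> charts_at M y" "d \<in> charts_at M y" for c d
      using D[OF v(1) that] D[OF v(2) that] linear_add[OF lin[OF that]] by simp
    moreover have "(v + w) c = 0" if "c \<notin> charts_at M y" for c
      using Z[OF v(1) that] Z[OF v(2) that] by simp
    ultimately show "v + w \<in> tspace M y"
      unfolding tspace_def by blast
  next
    fix a v assume v: "v \<in> tspace M y"
    have "(a *\<^sub>R v) d = transition_deriv c d y ((a *\<^sub>R v) c)"
      if "c \<in> charts_at M y" "d \<in> charts_at M y" for c d
      using D[OF v(1) that] linear_scale[OF lin[OF that]] by (simp add: scaleR_fun_def)
    moreover have "(a *\<^sub>R v) c = 0" if "c \<notin> charts_at M y" for c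
      using Z[OF v that] by (simp add: scaleR_fun_def)
    ultimately show "a *\<^sub>R v \<in> tspace M y"
      unfolding tspace_def by blast
  qed
qed

end

subsection \<open>Riemannian gradients and Hessians in coordinates\<close>

text \<open>\<open>Q\<close> inverts the Gram map \<open>A\<close> of \<open>B\<close>; definiteness
  makes \<open>A\<close> injective, hence bijective in finite dimension. For \<open>B\<close> the
  metric in a chart, \<open>Q\<close> raises an index: it takes the Euclidean gradient to the
  coordinates of the Riemannian one.\<close>

lemma riesz_form:
  fixes B :: "'a::euclidean_space \<Rightarrow> 'a \<Rightarrow> real"
  assumes "bilinear B" "\<And>\<xi>. \<xi> \<noteq> 0 \<Longrightarrow> B \<xi> \<xi> \<noteq> 0"
  obtains Q where "linear Q" "\<And>a \<eta>. B (Q a) \<eta> = a \<bullet> \<eta>"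
proof -
  define A where "A \<xi> = (\<Sum>i\<in>Basis. B \<xi> i *\<^sub>R i)" for \<xi>
  have lin: "linear (\<lambda>\<xi>. B \<xi> \<eta>)" "linear (B \<xi>)" for \<xi> \<eta>
    using assms(1) unfolding bilinear_def by auto
  have A: "A \<xi> \<bullet> \<eta> = B \<xi> \<eta>" for \<xi> \<eta>
  proof -
    have "B \<xi> \<eta> = B \<xi> (\<Sum>i\<in>Basis. (\<eta> \<bullet> i) *\<^sub>R i)" by (simp add: euclidean_representation)
    also have "\<dots> = (\<Sum>i\<in>Basis. (\<eta> \<bullet> i) * B \<xi> i)"
      by (simp add: linear_sum[OF lin(2)] linear_cmul[OF lin(2)])
    finally show ?thesis by (simp add: A_def inner_sum_left inner_commute[of \<eta>] mult.commute)
  qed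
  have "linear A"
    unfolding A_def
    by (intro linearI) (simp_all add: linear_add[OF lin(1)] linear_cmul[OF lin(1)]
      scaleR_add_left sum.distrib scaleR_sum_right)
  moreover have "\<xi> = 0" if "A \<xi> = 0" for \<xi>
    using A[of \<xi> \<xi>] that assms(2) by auto
  ultimately have "inj A" by (simp add: linear_injective_0)
  from linear_injective_isomorphism[OF \<open>linear A\<close> this]
  obtain Q where "linear Q" "\<And>a. A (Q a) = a" by blast
  then show ?thesis using that[of Q] A by metis
qed

context
  fixes M :: "('m, 'e::euclidean_space) manifold"
  assumes rm: "riemannian_manifold M"
begin

lemma smooth_riemannian: "smooth_manifold M"
  using rm unfolding riemannian_manifold_def by blast

lemma
  assumes "y \<in> carrier M" "v \<in> tspace M y" "w \<in> tspace M y"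
  shows rmetric_commute: "rmetric M y v w = rmetric M y w v"
    and rmetric_add_left: "z \<in> tspace M y \<Longrightarrow> rmetric M y (v + w) z = rmetric M y v z + rmetric M y w z"
    and rmetric_scale_left: "rmetric M y (a *\<^sub>R v) w = a * rmetric M y v w"
    and rmetric_pos: "v \<noteq> 0 \<Longrightarrow> rmetric M y v v > 0"
  using rm assms unfolding riemannian_manifold_def by blast+

lemma rmetric_add_right:
  assumes "y \<in> carrier M" "v \<in> tspace M y" "w \<in> tspace M y" "z \<in> tspace M y"
  shows "rmetric M y z (v + w) = rmetric M y z v + rmetric M y z w"
  using rmetric_add_left[OF assms] rmetric_commute[OF assms(1)] assms
    subspace_add[OF subspace_tspace[OF smooth_riemannian], of v y w] by simp

lemma rmetric_scale_right:
  assumes "y \<in> carrier M" "v \<in> tspace M y" "w \<in> tspace M y"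
  shows "rmetric M y w (a *\<^sub>R v) = a * rmetric M y w v"
  using rmetric_scale_left[OF assms, of a] rmetric_commute[OF assms] rmetric_commute[OF assms(1) _ assms(3)]
    subspace_scale[OF subspace_tspace[OF smooth_riemannian] assms(2), of a] by metis

lemma rmetric_diff_left:
  assumes "y \<in> carrier M" "v \<in> tspace M y" "w \<in> tspace M y" "z \<in> tspace M y"
  shows "rmetric M y (v - w) z = rmetric M y v z - rmetric M y w z"
  using rmetric_add_left[OF assms(1) _ assms(3,4), of "v - w"]
    subspace_diff[OF subspace_tspace[OF smooth_riemannian] assms(2,3)] by simp

lemma rmetric_zero_left:
  assumes "y \<in> carrier M" "w \<in> tspace M y"
  shows "rmetric M y 0 w = 0"
  using rmetric_scale_left[OF assms(1) subspace_0[OF subspace_tspace[OF smooth_riemannian]] assms(2), of 0]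
  by simp

lemma rmetric_nonneg:
  assumes "y \<in> carrier M" "v \<in> tspace M y"
  shows "rmetric M y v v \<ge> 0"
  using rmetric_pos[OF assms assms(2)] rmetric_zero_left[OF assms] by (cases "v = 0") auto

lemma tnorm_nonneg: "y \<in> carrier M \<Longrightarrow> v \<in> tspace M y \<Longrightarrow> tnorm M y v \<ge> 0"
  unfolding tnorm_def using rmetric_nonneg by simp

lemma tnorm_square: "y \<in> carrier M \<Longrightarrow> v \<in> tspace M y \<Longrightarrow> (tnorm M y v)\<^sup>2 = rmetric M y v v"
  unfolding tnorm_def using rmetric_nonneg by simp

lemma tnorm_pos: "y \<in> carrier M \<Longrightarrow> v \<in> tspace M y \<Longrightarrow> v \<noteq> 0 \<Longrightarrow> tnorm M y v > 0"
  unfolding tnorm_def using rmetric_pos by simp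

lemma charts_at_carrier: "c \<in> charts_at M y \<Longrightarrow> y \<in> carrier M"
  using chart_dom_carrier[OF smooth_riemannian] unfolding charts_at_def by blast

lemma rmetric_coord_bilinear:
  assumes "c \<in> charts_at M y"
  shows "bilinear (\<lambda>\<xi> \<eta>. rmetric M y (tlift M c y \<xi>) (tlift M c y \<eta>))"
proof -
  note t = tlift_tspace[OF smooth_riemannian assms]
  note l = linear_tlift[OF smooth_riemannian assms]
  note y = charts_at_carrier[OF assms]
  show ?thesis
    unfolding bilinear_def
    by (auto intro!: linearI simp: linear_add[OF l] linear_cmul[OF l]
        rmetric_add_left[OF y t t t] rmetric_add_right[OF y t t t]
        rmetric_scale_left[OF y t t] rmetric_scale_right[OF y t t])
qed

lemma rmetric_coord_definite:
  assumes "c \<in> charts_at M y" "\<xi> \<noteq> 0"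
  shows "rmetric M y (tlift M c y \<xi>) (tlift M c y \<xi>) > 0"
proof -
  have "tlift M c y \<xi> \<noteq> 0"
    using tlift_apply[OF smooth_riemannian assms(1), of \<xi>] assms(2) by (metis zero_fun_apply)
  then show ?thesis
    using rmetric_pos[OF charts_at_carrier[OF assms(1)]] tlift_tspace[OF smooth_riemannian assms(1)] by blast
qed

lemma rmetric_coord_riesz:
  assumes c: "c \<in> charts_at M y"
  shows "\<exists>Q. linear Q \<and> (\<forall>a \<eta>. rmetric M y (tlift M c y (Q a)) (tlift M c y \<eta>) = a \<bullet> \<eta>)"
proof -
  have "rmetric M y (tlift M c y \<xi>) (tlift M c y \<xi>) \<noteq> 0" if "\<xi> \<noteq> 0" for \<xi>
    using rmetric_coord_definite[OF c that] by simp
  from riesz_form[OF rmetric_coord_bilinear[OF c] this] show ?thesis by metis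
qed

lemma rmetric_nondegenerate:
  assumes "y \<in> carrier M" "v \<in> tspace M y" "w \<in> tspace M y"
    and "\<And>z. z \<in> tspace M y \<Longrightarrow> rmetric M y v z = rmetric M y w z"
  shows "v = w"
proof -
  have t: "v - w \<in> tspace M y" 
    using subspace_diff[OF subspace_tspace[OF smooth_riemannian] assms(2,3)] .
  then have "rmetric M y (v - w) (v - w) = 0"
    using rmetric_diff_left[OF assms(1-3) t] assms(4)[OF t] by simp
  then show ?thesis using rmetric_pos[OF assms(1) t t] by fastforce
qed

text \<open>The definite description in \<open>tgrad\<close> refers to all charts at
  \<open>y\<close>, yet a derivative in one of them suffices: other coordinates differ by an
  invertible linear map, and nondegeneracy of the metric gives uniqueness.\<close>

lemma tgrad_spec:
  assumes c: "c \<in> charts_at M y" and s: "s \<in> tspace M y"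
    and D: "((\<lambda>\<xi>. h (tlift M c y \<xi>)) has_derivative D) (at (s c))"
  shows "tgrad M y h s \<in> tspace M y"
    and "\<And>w. w \<in> tspace M y \<Longrightarrow> rmetric M y (tgrad M y h s) w = D (w c)"
proof -
  note sm = smooth_riemannian
  note y = charts_at_carrier[OF c]
  let ?P = "\<lambda>G. G \<in> tspace M y \<and> (\<forall>c\<in>charts_at M y.
        ((\<lambda>\<xi>. h (tlift M c y \<xi>)) has_derivative (\<lambda>\<eta>. rmetric M y G (tlift M c y \<eta>))) (at (s c)))"
  obtain Q where "linear Q" and Q: "\<And>a \<eta>. rmetric M y (tlift M c y (Q a)) (tlift M c y \<eta>) = a \<bullet> \<eta>"
    using rmetric_coord_riesz[OF c] by metis
  \<comment> \<open>The vector with entries \<open>D i\<close> is the Euclidean gradient in the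
    chart; \<open>Q\<close> converts it into the representer for the metric.\<close>
  define G where "G = tlift M c y (Q (\<Sum>i\<in>Basis. D i *\<^sub>R i))"
  have "linear D" using D by (rule has_derivative_linear)
  have G: "rmetric M y G (tlift M c y \<eta>) = D \<eta>" for \<eta>
  proof -
    have "D \<eta> = D (\<Sum>i\<in>Basis. (\<eta> \<bullet> i) *\<^sub>R i)" by (simp add: euclidean_representation)
    also have "\<dots> = (\<Sum>i\<in>Basis. (\<eta> \<bullet> i) * D i)"
      by (simp add: linear_sum[OF \<open>linear D\<close>] linear_cmul[OF \<open>linear D\<close>])
    finally show ?thesis by (simp add: G_def Q inner_sum_left inner_commute[of \<eta>] mult.commute)
  qed
  have "?P G"
  proof (intro conjI ballI)
    fix d assume d: "d \<in> charts_at M y"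
    have "((\<lambda>\<xi>. h (tlift M c y \<xi>)) \<circ> transition_deriv d c y has_derivative
        D \<circ> transition_deriv d c y) (at (s d))"
      using D tspace_transition[OF sm s d c] by (intro diff_chain_at bounded_linear_imp_has_derivative transition_linear[OF sm d c]) simp
    then show "((\<lambda>\<xi>. h (tlift M d y \<xi>)) has_derivative (\<lambda>\<eta>. rmetric M y G (tlift M d y \<eta>))) (at (s d))"
      by (simp add: o_def tlift_transition[OF sm d c] G[symmetric])
  qed (simp add: G_def tlift_tspace[OF sm c])
  moreover have "G' = G" if "?P G'" for G'
  proof (rule rmetric_nondegenerate[OF y])
    fix z assume "z \<in> tspace M y"
    moreover have "(\<lambda>\<eta>. rmetric M y G' (tlift M c y \<eta>)) = D"
      using that c D by (intro has_derivative_unique) auto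
    ultimately show "rmetric M y G' z = rmetric M y G z"
      using tlift_coord[OF sm c, of z] G[of "z c"] by (metis)
  qed (use that \<open>?P G\<close> in auto)
  ultimately have "(THE G. ?P G) = G"
    by (rule the_equality)
  then have "tgrad M y h s = G"
    unfolding tgrad_def .
  then show "tgrad M y h s \<in> tspace M y" using \<open>?P G\<close> by simp
  fix w assume "w \<in> tspace M y"
  from tlift_coord[OF sm c this] G[of "w c"] \<open>tgrad M y h s = G\<close>
  show "rmetric M y (tgrad M y h s) w = D (w c)" by simp
qed

text \<open>On the fixed space \<open>tspace M y\<close> the metric is constant, so the coordinates
  of the gradient are a constant linear image of the Euclidean gradient, and differentiating them
  along \<open>v\<close> commutes with pairing against \<open>w\<close>. Hence \<open>w\<close> is
  the inner direction and \<open>v\<close> the outer one.\<close>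

lemma thess_spec:
  assumes C2: "\<And>c. c \<in> charts_at M y \<Longrightarrow> Ck_on 2 UNIV (\<lambda>\<xi>. h (tlift M c y \<xi>))"
    and c: "c \<in> charts_at M y" and s: "s \<in> tspace M y" and v: "v \<in> tspace M y"
  shows "thess M y h s v \<in> tspace M y"
    and "\<And>w. w \<in> tspace M y \<Longrightarrow> rmetric M y (thess M y h s v) w =
      ddir (v c) (ddir (w c) (\<lambda>\<xi>. h (tlift M c y \<xi>))) (s c)"
proof -
  note sm = smooth_riemannian
  note y = charts_at_carrier[OF c]
  define \<phi> where "\<phi> c \<xi> = h (tlift M c y \<xi>)" for c \<xi>
  define \<psi> where "\<psi> c \<xi> = tgrad M y h (tlift M c y \<xi>) c" for c \<xi>
  have C: "Ck_on (Suc (Suc 0)) UNIV (\<phi> c)" if "c \<in> charts_at M y" for c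
    using C2[OF that] by (simp add: \<phi>_def[abs_def] numeral_2_eq_2)
  have grad: "tgrad M y h t \<in> tspace M y"
    "\<And>w. w \<in> tspace M y \<Longrightarrow> rmetric M y (tgrad M y h t) w = ddir (w c) (\<phi> c) (t c)"
    if "t \<in> tspace M y" "c \<in> charts_at M y" for t c
    using tgrad_spec[OF that(2,1) Ck_on_has_derivative[OF C[OF that(2), unfolded \<phi>_def], OF UNIV_I]]
    by (simp_all add: \<phi>_def[abs_def])
  have der: "\<exists>D. (\<psi> d has_derivative D) (at (s d)) \<and>
      (\<forall>\<nu> \<eta>. rmetric M y (tlift M d y (D \<nu>)) (tlift M d y \<eta>) = ddir \<nu> (ddir \<eta> (\<phi> d)) (s d))"
    if d: "d \<in> charts_at M y" for d
  proof -
    note lift = tlift_tspace[OF sm d]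
    obtain Q where "linear Q" and Q: "\<And>a \<eta>. rmetric M y (tlift M d y (Q a)) (tlift M d y \<eta>) = a \<bullet> \<eta>"
      using rmetric_coord_riesz[OF d] by metis
    have rep: "ddir \<eta> (\<phi> d) \<xi> = (\<Sum>i\<in>Basis. (\<eta> \<bullet> i) *\<^sub>R ddir i (\<phi> d) \<xi>)" for \<eta> \<xi>
    proof -
      have lin: "linear (frechet_derivative (\<phi> d) (at \<xi>))"
        using C[OF d] by (simp add: linear_frechet_derivative)
      have "frechet_derivative (\<phi> d) (at \<xi>) (\<Sum>i\<in>Basis. (\<eta> \<bullet> i) *\<^sub>R i)
          = (\<Sum>i\<in>Basis. (\<eta> \<bullet> i) *\<^sub>R ddir i (\<phi> d) \<xi>)"
        by (simp add: linear_sum[OF lin] linear_cmul[OF lin])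
      then show ?thesis by (simp add: euclidean_representation)
    qed
    \<comment> \<open>\<open>Q\<close> does not depend on \<xi>, which is what lets the next
      derivative pass through it.\<close>
    have "\<psi> d \<xi> = Q (\<Sum>i\<in>Basis. ddir i (\<phi> d) \<xi> *\<^sub>R i)" for \<xi>
    proof -
      have "tgrad M y h (tlift M d y \<xi>) = tlift M d y (Q (\<Sum>i\<in>Basis. ddir i (\<phi> d) \<xi> *\<^sub>R i))"
      proof (rule rmetric_nondegenerate[OF y grad(1)[OF lift d] lift])
        fix z assume z: "z \<in> tspace M y"
        have "rmetric M y (tlift M d y (Q (\<Sum>i\<in>Basis. ddir i (\<phi> d) \<xi> *\<^sub>R i))) z
            = (\<Sum>i\<in>Basis. ddir i (\<phi> d) \<xi> *\<^sub>R i) \<bullet> z d"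
          using Q[of _ "z d"] tlift_coord[OF sm d z] by simp
        also have "\<dots> = ddir (z d) (\<phi> d) \<xi>"
          by (simp add: rep[where \<eta> = "z d"] inner_sum_left inner_commute[of "z d"] mult.commute)
        finally show "rmetric M y (tgrad M y h (tlift M d y \<xi>)) z
            = rmetric M y (tlift M d y (Q (\<Sum>i\<in>Basis. ddir i (\<phi> d) \<xi> *\<^sub>R i))) z"
          using grad(2)[OF lift d z] tlift_apply[OF sm d] by simp
      qed
      then show ?thesis by (simp add: \<psi>_def tlift_apply[OF sm d])
    qed
    then have \<psi>: "\<psi> d = (\<lambda>\<xi>. Q (\<Sum>i\<in>Basis. ddir i (\<phi> d) \<xi> *\<^sub>R i))" ..
    have C1: "Ck_on (Suc 0) UNIV (ddir i (\<phi> d))" for i using C[OF d] by simp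
    let ?D = "\<lambda>\<nu>. Q (\<Sum>i\<in>Basis. ddir \<nu> (ddir i (\<phi> d)) (s d) *\<^sub>R i)"
    have "(\<psi> d has_derivative ?D) (at (s d))"
      unfolding \<psi>
      by (intro bounded_linear.has_derivative[OF linear_conv_bounded_linear[THEN iffD1, OF \<open>linear Q\<close>]]
          has_derivative_sum has_derivative_scaleR_left Ck_on_has_derivative[OF C1 UNIV_I])
    moreover have "rmetric M y (tlift M d y (?D \<nu>)) (tlift M d y \<eta>) = ddir \<nu> (ddir \<eta> (\<phi> d)) (s d)" for \<nu> \<eta>
    proof -
      have "ddir \<nu> (ddir \<eta> (\<phi> d)) (s d) = dir_derivs [\<nu>] (\<lambda>\<xi>. \<Sum>i\<in>Basis. (\<eta> \<bullet> i) *\<^sub>R ddir i (\<phi> d) \<xi>) (s d)"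
        by (simp add: rep[where \<eta> = \<eta>, abs_def])
      also have "\<dots> = (\<Sum>i\<in>Basis. (\<eta> \<bullet> i) *\<^sub>R dir_derivs [\<nu>] (ddir i (\<phi> d)) (s d))"
        by (rule dir_derivs_sum[of UNIV]) (use C1 in auto)
      finally show ?thesis by (simp add: Q inner_sum_left inner_commute[of \<eta>] mult.commute)
    qed
    ultimately show ?thesis by (intro exI[of _ ?D]) simp
  qed
  then obtain D where D: "\<And>d. d \<in> charts_at M y \<Longrightarrow> (\<psi> d has_derivative D d) (at (s d))"
    "\<And>d \<nu> \<eta>. d \<in> charts_at M y \<Longrightarrow>
      rmetric M y (tlift M d y (D d \<nu>)) (tlift M d y \<eta>) = ddir \<nu> (ddir \<eta> (\<phi> d)) (s d)"
    by metis
  have th: "thess M y h s v d = D d (v d)" if "d \<in> charts_at M y" for d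
    using frechet_derivative_at[OF D(1)[OF that]] that
    by (simp add: thess_def \<psi>_def[abs_def])
  have "thess M y h s v e = transition_deriv d e y (thess M y h s v d)"
    if d: "d \<in> charts_at M y" and e: "e \<in> charts_at M y" for d e
  proof -
    note T = transition_linear[OF sm]
    \<comment> \<open>Change of chart conjugates the gradient field by a constant linear map; its
      derivative is conjugated in the same way, so the coordinate Hessians fit together to a tangent
      vector.\<close>
    have "\<psi> e = transition_deriv d e y \<circ> (\<psi> d \<circ> transition_deriv e d y)"
    proof
      fix \<xi>
      have "tgrad M y h (tlift M e y \<xi>) \<in> tspace M y" using grad(1)[OF tlift_tspace[OF sm e] e] .
      then have "\<psi> e \<xi> = transition_deriv d e y (tgrad M y h (tlift M e y \<xi>) d)"
        unfolding \<psi>_def using tspace_transition[OF sm] d e by metis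
      then show "\<psi> e \<xi> = (transition_deriv d e y \<circ> (\<psi> d \<circ> transition_deriv e d y)) \<xi>"
        by (simp add: \<psi>_def tlift_transition[OF sm e d])
    qed
    moreover have "(transition_deriv d e y \<circ> (\<psi> d \<circ> transition_deriv e d y) has_derivative
        transition_deriv d e y \<circ> (D d \<circ> transition_deriv e d y)) (at (s e))"
      using D(1)[OF d] tspace_transition[OF sm s e d]
      by (intro diff_chain_at bounded_linear_imp_has_derivative T[OF d e] T[OF e d]) simp
    ultimately have "D e = transition_deriv d e y \<circ> (D d \<circ> transition_deriv e d y)"
      using D(1)[OF e] has_derivative_unique by metis
    then show ?thesis by (simp add: th[OF d] th[OF e] tspace_transition[OF sm v e d])
  qed
  moreover have "thess M y h s v d = 0" if "d \<notin> charts_at M y" for d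
    using that by (simp add: thess_def)
  ultimately show t: "thess M y h s v \<in> tspace M y"
    unfolding tspace_def by blast
  fix w assume w: "w \<in> tspace M y"
  show "rmetric M y (thess M y h s v) w = ddir (v c) (ddir (w c) (\<lambda>\<xi>. h (tlift M c y \<xi>))) (s c)"
    using D(2)[OF c, of "v c" "w c"] tlift_coord[OF sm c w] tlift_coord[OF sm c t] th[OF c]
    by (simp add: \<phi>_def[abs_def])
qed

end

subsection \<open>The pullback in coordinates\<close>

text \<open>Both estimates at one point, bundled so that a single constant can be enlarged for both
  at once.\<close>

definition cubic_bound ::
  "('m, 'e::euclidean_space) manifold \<Rightarrow> real \<Rightarrow> 'm \<Rightarrow> (('m, 'e) tvec \<Rightarrow> real) \<Rightarrow> ('m, 'e) tvec \<Rightarrow> bool"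
  where "cubic_bound M L y h s \<longleftrightarrow>
    h s - taylor2 M y h s \<le> L / 6 * tnorm M y s ^ 3 \<and>
    tnorm M y (tgrad M y h s - tgrad M y h 0 - thess M y h 0 s) \<le> L / 2 * (tnorm M y s)\<^sup>2"

text \<open>Regularity of \<open>f\<close> is known only in charts around the values of
  \<open>R\<close>, and one chart around those values may not do. The domain is covered by the open
  preimages \<open>W d\<close> of the target charts; on each of them the pullback is
  \<open>f\<close> in the chart \<open>d\<close> after the smooth coordinate form of
  \<open>R\<close>.\<close>

lemma Ck_on_pullback:
  fixes M :: "('m, 'e::euclidean_space) manifold"
  assumes sm: "smooth_manifold M" and R: "retraction_on M R" and f: "Ck_function n M f" and c: "c \<in> atlas M"
  shows "Ck_on n (chart_img c \<times> UNIV) (\<lambda>(u, \<xi>). pullback R f (chart_inv c u) (tlift M c (chart_inv c u) \<xi>))"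
proof -
  define F where "F = (\<lambda>(u, \<xi>). R (chart_inv c u) (tlift M c (chart_inv c u) \<xi>))"
  define W where "W d = {p \<in> chart_img c \<times> UNIV. F p \<in> chart_dom d}" for d :: "('m, 'e) chart"
  have "F p \<in> carrier M" if mem: "p \<in> chart_img c \<times> UNIV" for p
  proof -
    obtain u \<xi> where p: "p = (u, \<xi>)" "u \<in> chart_img c" using mem by auto
    have "c \<in> charts_at M (chart_inv c u)" using c chart_inv_dom[OF p(2)] by (simp add: charts_at_def)
    then have "tlift M c (chart_inv c u) \<xi> \<in> tspace M (chart_inv c u)" by (rule tlift_tspace[OF sm])
    moreover have "chart_inv c u \<in> carrier M" using chart_dom_carrier[OF sm c chart_inv_dom[OF p(2)]] .
    ultimately show ?thesis using R unfolding retraction_on_def F_def p(1) by simp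
  qed
  then have cover: "chart_img c \<times> UNIV = (\<Union>d\<in>atlas M. W d)"
    using charts_at_nonempty[OF sm] unfolding W_def charts_at_def by fastforce
  have W: "open (W d)" "smooth_on (W d) (chart_map d \<circ> F)" if "d \<in> atlas M" for d
    using R c that unfolding retraction_on_def smooth_on_bundle_def W_def F_def Let_def by blast+
  have "Ck_on n (W d) (f \<circ> F)" if d: "d \<in> atlas M" for d
  proof (rule Ck_on_cong[OF W(1)[OF d]])
    show "Ck_on n (W d) ((f \<circ> chart_inv d) \<circ> (chart_map d \<circ> F))"
    proof (rule Ck_on_compose[OF W(1)[OF d] chart_homeo(3)[OF sm d]])
      show "(chart_map d \<circ> F) ` W d \<subseteq> chart_img d" by (auto simp: W_def chart_img_def)
      show "Ck_on n (chart_img d) (f \<circ> chart_inv d)" using f d by (simp add: Ck_function_def)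
      show "Ck_on n (W d) (chart_map d \<circ> F)" using W(2)[OF d] by (simp add: smooth_on_def)
    qed
    show "((f \<circ> chart_inv d) \<circ> (chart_map d \<circ> F)) p = (f \<circ> F) p" if "p \<in> W d" for p
      using chart_inv_map[OF sm d, of "F p"] that by (simp add: W_def)
  qed
  then have "Ck_on n (\<Union>d\<in>atlas M. W d) (f \<circ> F)" by (intro Ck_on_UN W(1))
  moreover have "f \<circ> F = (\<lambda>(u, \<xi>). pullback R f (chart_inv c u) (tlift M c (chart_inv c u) \<xi>))"
    by (auto simp: F_def pullback_def)
  ultimately show ?thesis by (simp add: cover)
qed

text \<open>Supplies the closedness of sublevel sets when the manifold is compact.\<close>

lemma continuous_map_Ck_function:
  assumes sm: "smooth_manifold M" and f: "Ck_function n M f"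
  shows "continuous_map (mtop M) euclideanreal f"
proof (rule pasting_lemma[where I = "atlas M" and T = chart_dom and f = "\<lambda>_. f"])
  fix c assume c: "c \<in> atlas M"
  show "openin (mtop M) (chart_dom c)" using chart_homeo(2)[OF sm c] .
  have "Ck_on 0 (chart_img c) (f \<circ> chart_inv c)"
    by (rule Ck_on_le[of n]) (use f c in \<open>simp_all add: Ck_function_def\<close>)
  then have "continuous_map (top_of_set (chart_img c)) euclideanreal (f \<circ> chart_inv c)"
    by simp
  from continuous_map_compose[OF homeomorphic_imp_continuous_map[OF chart_homeo(1)[OF sm c]] this]
  show "continuous_map (subtopology (mtop M) (chart_dom c)) euclideanreal f"
    by (rule continuous_map_eq) (use chart_homeo(4)[OF sm c] chart_inv_map[OF sm c] in auto)
next
  show "\<exists>c. c \<in> atlas M \<and> y \<in> chart_dom c \<and> f y = f y" if "y \<in> topspace (mtop M)" for y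
    using charts_at_nonempty[OF sm, of y] that by (auto simp: carrier_def charts_at_def)
qed simp_all

section \<open>Coordinate forms of the norm and of the Taylor polynomial\<close>

context
  fixes M :: "('m, 'e::euclidean_space) manifold"
  assumes rm: "riemannian_manifold M"
begin

lemma tlift_zero: "c \<in> charts_at M y \<Longrightarrow> tlift M c y 0 = 0"
  using linear_0[OF linear_tlift[OF smooth_riemannian[OF rm]]] .

lemma rmetric_metric_coeff:
  assumes "c \<in> charts_at M y" "v \<in> tspace M y" "w \<in> tspace M y"
  shows "rmetric M y v w = metric_coeff M c (chart_map c y) (v c) (w c)"
  using assms chart_inv_map[OF smooth_riemannian[OF rm], of c y] tlift_coord[OF smooth_riemannian[OF rm] assms(1)]
  by (simp add: metric_coeff_def Let_def charts_at_def)

text \<open>The metric has a positive minimum \<open>m\<close> over \<open>Q\<close> times the unit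
  sphere, and homogeneity extends this to all vectors with \<open>a = sqrt m\<close>.\<close>

lemma tnorm_lower_bound:
  assumes c: "c \<in> atlas M" and Q: "compact Q" "Q \<subseteq> chart_img c"
  shows "\<exists>a>0. \<forall>y\<in>chart_dom c. chart_map c y \<in> Q \<longrightarrow> (\<forall>v\<in>tspace M y. a * norm (v c) \<le> tnorm M y v)"
proof (cases "Q = {}")
  case False
  note sm = smooth_riemannian[OF rm]
  define G where "G u \<xi> \<eta> = metric_coeff M c u \<xi> \<eta>" for u \<xi> \<eta>
  have G: "bilinear (G u)" "\<And>\<xi>. \<xi> \<noteq> 0 \<Longrightarrow> G u \<xi> \<xi> > 0" if "u \<in> chart_img c" for u
  proof -
    have "c \<in> charts_at M (chart_inv c u)" using chart_inv_dom[OF that] c by (simp add: charts_at_def)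
    from rmetric_coord_bilinear[OF rm this] rmetric_coord_definite[OF rm this]
    show "bilinear (G u)" "\<And>\<xi>. \<xi> \<noteq> 0 \<Longrightarrow> G u \<xi> \<xi> > 0"
      by (simp_all add: G_def[abs_def] metric_coeff_def Let_def)
  qed
  \<comment> \<open>The coefficients are continuous in \<open>u\<close> for fixed arguments only;
    the expansion in the basis gives continuity in point and vector jointly.\<close>
  have expand: "G u \<xi> \<xi> = (\<Sum>i\<in>Basis. \<Sum>j\<in>Basis. (\<xi> \<bullet> i) * (\<xi> \<bullet> j) * G u j i)" if "u \<in> chart_img c" for u \<xi>
  proof -
    have lin: "linear (\<lambda>\<xi>. G u \<xi> \<eta>)" "linear (G u \<xi>)" for \<xi> \<eta>
      using G(1)[OF that] unfolding bilinear_def by auto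
    have "G u \<xi> \<xi> = G u (\<Sum>i\<in>Basis. (\<xi> \<bullet> i) *\<^sub>R i) (\<Sum>j\<in>Basis. (\<xi> \<bullet> j) *\<^sub>R j)"
      by (simp add: euclidean_representation)
    also have "\<dots> = (\<Sum>i\<in>Basis. \<Sum>j\<in>Basis. (\<xi> \<bullet> i) * (\<xi> \<bullet> j) * G u j i)"
      by (simp only: linear_sum[OF lin(1)] linear_sum[OF lin(2)] linear_cmul[OF lin(1)] linear_cmul[OF lin(2)])
        (simp add: sum_distrib_left mult.assoc)
    finally show ?thesis .
  qed
  have "continuous_on (chart_img c) (\<lambda>u. G u i j)" for i j
    using rm c unfolding riemannian_manifold_def smooth_on_def G_def by (metis Ck_on.simps(1))
  then have "continuous_on (Q \<times> sphere 0 1) (\<lambda>p. G (fst p) i j)" for i j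
    using Q(2) by (intro continuous_on_compose2[of "chart_img c" "\<lambda>u. G u i j" _ fst]) (auto intro: continuous_intros)
  then have "continuous_on (Q \<times> sphere 0 1)
      (\<lambda>p. \<Sum>i\<in>Basis. \<Sum>j\<in>Basis. (snd p \<bullet> i) * (snd p \<bullet> j) * G (fst p) j i)"
    by (intro continuous_intros)
  then have cont: "continuous_on (Q \<times> sphere 0 1) (\<lambda>p. G (fst p) (snd p) (snd p))"
    by (rule continuous_on_eq) (use expand Q(2) in force)
  \<comment> \<open>A minimum needs a nonempty set: \<open>Q\<close> is nonempty in this case, and
    the model space has positive dimension.\<close>
  have "Q \<times> sphere (0::'e) 1 \<noteq> {}"
    using False vector_choose_size[of 1, where ?'a = 'e] by auto
  from continuous_attains_inf[OF _ this cont] Q(1)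
  obtain u0 \<xi>0 where p: "u0 \<in> Q" "norm \<xi>0 = 1"
    "\<And>u \<xi>. u \<in> Q \<Longrightarrow> norm \<xi> = 1 \<Longrightarrow> G u0 \<xi>0 \<xi>0 \<le> G u \<xi> \<xi>"
    by (force simp: compact_Times)
  define m where "m = G u0 \<xi>0 \<xi>0"
  have "\<xi>0 \<noteq> 0" using p(2) by auto
  then have "m > 0" using p(1) Q(2) G(2)[of u0 \<xi>0] by (auto simp: m_def)
  have "sqrt m * norm (v c) \<le> tnorm M y v"
    if y: "y \<in> chart_dom c" "chart_map c y \<in> Q" and v: "v \<in> tspace M y" for y v
  proof -
    have cy: "c \<in> charts_at M y" using c y(1) by (simp add: charts_at_def)
    let ?u = "chart_map c y" and ?n = "norm (v c)"
    have "m * ?n\<^sup>2 \<le> G ?u (v c) (v c)"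
    proof (cases "v c = 0")
      case True
      then show ?thesis using bilinear_lzero[OF G(1)] Q(2) y(2) by auto
    next
      case nz: False
      have b: "bilinear (G ?u)" using G(1) Q(2) y(2) by auto
      have "m \<le> G ?u (inverse ?n *\<^sub>R v c) (inverse ?n *\<^sub>R v c)"
        unfolding m_def using nz by (intro p(3) y(2)) simp
      also have "\<dots> = inverse ?n * inverse ?n * G ?u (v c) (v c)"
        by (simp add: bilinear_lmul[OF b] bilinear_rmul[OF b])
      finally have "m * ?n\<^sup>2 \<le> (inverse ?n * inverse ?n * G ?u (v c) (v c)) * ?n\<^sup>2"
        by (rule mult_right_mono) simp
      also have "\<dots> = G ?u (v c) (v c)" using nz by (simp add: power2_eq_square field_simps)
      finally show ?thesis .
    qed
    then have "sqrt (m * ?n\<^sup>2) \<le> tnorm M y v"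
      unfolding tnorm_def rmetric_metric_coeff[OF cy v v] G_def by (rule real_sqrt_le_mono)
    then show ?thesis by (simp add: real_sqrt_mult)
  qed
  then show ?thesis using \<open>m > 0\<close> by (intro exI[of _ "sqrt m"]) auto
qed (intro exI[of _ 1], auto)

text \<open>Chart coordinates are linear on one tangent space, so the metric cancels from the Taylor
  polynomial and from pairings with the gradient error, leaving Euclidean directional
  derivatives.\<close>

lemma taylor2_coord:
  assumes C2: "\<And>c. c \<in> charts_at M y \<Longrightarrow> Ck_on 2 UNIV (\<lambda>\<xi>. h (tlift M c y \<xi>))"
    and c: "c \<in> charts_at M y" and s: "s \<in> tspace M y"
  defines "\<phi> \<equiv> \<lambda>\<xi>. h (tlift M c y \<xi>)"
  shows "taylor2 M y h s = \<phi> 0 + ddir (s c) \<phi> 0 + ddir (s c) (ddir (s c) \<phi>) 0 / 2"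
    and "tgrad M y h s - tgrad M y h 0 - thess M y h 0 s \<in> tspace M y"
    and "\<And>w. w \<in> tspace M y \<Longrightarrow> rmetric M y (tgrad M y h s - tgrad M y h 0 - thess M y h 0 s) w =
      ddir (w c) \<phi> (s c) - ddir (w c) \<phi> 0 - ddir (s c) (ddir (w c) \<phi>) 0"
proof -
  note sm = smooth_riemannian[OF rm]
  note y = charts_at_carrier[OF rm c]
  note sub = subspace_tspace[OF sm, of y]
  have "Ck_on (Suc 1) UNIV \<phi>" using C2[OF c] by (simp add: \<phi>_def numeral_2_eq_2)
  from Ck_on_has_derivative[OF this UNIV_I]
  have grad: "tgrad M y h t \<in> tspace M y"
    "\<And>w. w \<in> tspace M y \<Longrightarrow> rmetric M y (tgrad M y h t) w = ddir (w c) \<phi> (t c)" if "t \<in> tspace M y" for t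
    using tgrad_spec[OF rm c that, of h] unfolding \<phi>_def by blast+
  note zero = subspace_0[OF sub]
  have hess: "thess M y h 0 s \<in> tspace M y"
    "\<And>w. w \<in> tspace M y \<Longrightarrow> rmetric M y (thess M y h 0 s) w = ddir (s c) (ddir (w c) \<phi>) 0"
    using thess_spec[OF rm _ c zero s, of h] C2 unfolding \<phi>_def zero_fun_apply by blast+
  show "taylor2 M y h s = \<phi> 0 + ddir (s c) \<phi> 0 + ddir (s c) (ddir (s c) \<phi>) 0 / 2"
    using rmetric_commute[OF rm y s grad(1)[OF zero]] rmetric_commute[OF rm y s hess(1)]
      grad(2)[OF zero s] hess(2)[OF s] tlift_zero[OF c]
    by (simp add: taylor2_def \<phi>_def)
  have d: "tgrad M y h s - tgrad M y h 0 \<in> tspace M y"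
    using subspace_diff[OF sub grad(1)[OF s] grad(1)[OF zero]] .
  then show "tgrad M y h s - tgrad M y h 0 - thess M y h 0 s \<in> tspace M y"
    using subspace_diff[OF sub _ hess(1)] by blast
  fix w assume w: "w \<in> tspace M y"
  show "rmetric M y (tgrad M y h s - tgrad M y h 0 - thess M y h 0 s) w =
      ddir (w c) \<phi> (s c) - ddir (w c) \<phi> 0 - ddir (s c) (ddir (w c) \<phi>) 0"
    using rmetric_diff_left[OF rm y d hess(1) w] rmetric_diff_left[OF rm y grad(1)[OF s] grad(1)[OF zero] w]
      grad(2)[OF s w] grad(2)[OF zero w] hess(2)[OF w] by simp
qed

end

section \<open>Uniform constants, in one chart and on a compact set\<close>

lemma cubic_bound_mono:
  assumes "cubic_bound M L y h s" "L \<le> L'" "tnorm M y s \<ge> 0"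
  shows "cubic_bound M L' y h s"
proof -
  have "L / 6 * tnorm M y s ^ 3 \<le> L' / 6 * tnorm M y s ^ 3" "L / 2 * (tnorm M y s)\<^sup>2 \<le> L' / 2 * (tnorm M y s)\<^sup>2"
    using assms(2,3) by (auto intro!: mult_right_mono)
  then show ?thesis using assms(1) unfolding cubic_bound_def by linarith
qed

text \<open>Beyond 1 the linear term is dominated by the quadratic one, and dividing by
  \<open>n\<^sup>2\<close> leaves \<open>b * n \<le> C1 + C2\<close>.\<close>

lemma cubic_step_bound:
  fixes n :: real
  assumes "n \<ge> 0" "b > 0" "C1 \<ge> 0" "C2 \<ge> 0" "b * n ^ 3 \<le> C1 * n + C2 * n\<^sup>2"
  shows "n \<le> max 1 ((C1 + C2) / b)"
proof (rule ccontr)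
  assume "\<not> ?thesis"
  then have n: "1 < n" "(C1 + C2) / b < n" by auto
  have "C1 * n \<le> C1 * n\<^sup>2"
    using n(1) assms(3) by (intro mult_left_mono) (auto simp: power2_eq_square)
  then have "b * n ^ 3 \<le> (C1 + C2) * n\<^sup>2" using assms(5) by (simp add: distrib_right)
  then have "(b * n) * n\<^sup>2 \<le> (C1 + C2) * n\<^sup>2" by (simp add: power2_eq_square power3_eq_cube mult_ac)
  then have "b * n \<le> C1 + C2" using n(1) by simp
  then show False using n(2) assms(2) by (simp add: field_simps)
qed

text \<open>The constants arise in a fixed order: \<open>C1\<close> and \<open>C2\<close> at the
  origin determine the radius \<open>r\<close>, the radius determines \<open>C3\<close>, and
  \<open>C3\<close> determines \<open>L\<close>. None of them depends on \<open>y\<close>, \<sigma>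
  or \<open>s\<close>.\<close>

lemma local_cubic_bound:
  fixes M :: "('m, 'e::euclidean_space) manifold"
  assumes rm: "riemannian_manifold M" and R: "retraction_on M R" and f: "Ck_function 3 M f"
    and c: "c \<in> atlas M" and Q: "compact Q" "Q \<subseteq> chart_img c" and \<sigma>min: "\<sigma>min > 0"
  shows "\<exists>L\<ge>0. \<forall>y\<in>chart_dom c. chart_map c y \<in> Q \<longrightarrow>
    (\<forall>\<sigma>\<ge>\<sigma>min. \<forall>s\<in>tspace M y. arc_model M R f y \<sigma> s \<le> arc_model M R f y \<sigma> 0 \<longrightarrow>
      cubic_bound M L y (pullback R f y) s)"
proof -
  note sm = smooth_riemannian[OF rm]
  define F where "F c = (\<lambda>(u, \<xi>). pullback R f (chart_inv c u) (tlift M c (chart_inv c u) \<xi>))"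
    for c :: "('m, 'e) chart"
  \<comment> \<open>All charts \<open>d\<close> enter, not only \<open>c\<close>: the Hessian is a
    family over every chart at \<open>y\<close>, and its specification asks for regularity in
    each.\<close>
  have CF: "Ck_on 3 (chart_img d \<times> UNIV) (F d)" if "d \<in> atlas M" for d
    unfolding F_def by (rule Ck_on_pullback[OF sm R f that])
  have CF': "Ck_on k (chart_img c \<times> UNIV) (F c)" if "k \<le> 3" for k
    using Ck_on_le[OF CF[OF c] that] .
  have open_F: "open (chart_img c \<times> (UNIV :: 'e set))"
    by (intro open_Times chart_homeo(3)[OF sm c] open_UNIV)
  obtain a where a: "a > 0"
    "\<And>y v. y \<in> chart_dom c \<Longrightarrow> chart_map c y \<in> Q \<Longrightarrow> v \<in> tspace M y \<Longrightarrow> a * norm (v c) \<le> tnorm M y v"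
    using tnorm_lower_bound[OF rm c Q] by metis
  have bound: "\<exists>C\<ge>0. \<forall>u\<in>Q. \<forall>\<xi>\<in>cball 0 r. \<forall>vs. length vs = k \<longrightarrow>
      \<bar>dir_derivs vs (\<lambda>\<xi>. F c (u, \<xi>)) \<xi>\<bar> \<le> C * (\<Prod>v\<leftarrow>vs. norm v)" if "k \<le> 3" for k r
  proof -
    have "compact (Q \<times> cball (0::'e) r)" using Q(1) by (intro compact_Times) auto
    from dir_derivs_bound[OF open_F this _ CF'[OF that]] Q(2)
    obtain C where C: "C \<ge> 0" "\<And>p vs. p \<in> Q \<times> cball 0 r \<Longrightarrow> length vs = k \<Longrightarrow>
        norm (dir_derivs vs (F c) p) \<le> C * (\<Prod>v\<leftarrow>vs. norm v)" by blast
    have "\<bar>dir_derivs vs (\<lambda>\<xi>. F c (u, \<xi>)) \<xi>\<bar> \<le> C * (\<Prod>v\<leftarrow>vs. norm v)"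
      if "u \<in> Q" "\<xi> \<in> cball 0 r" "length vs = k" for u \<xi> vs
    proof -
      have "dir_derivs vs (\<lambda>\<xi>. F c (u, \<xi>)) \<xi> = dir_derivs (map (Pair 0) vs) (F c) (u, \<xi>)"
        by (rule dir_derivs_section[OF chart_homeo(3)[OF sm c]]) (use that Q CF' \<open>k \<le> 3\<close> in auto)
      then show ?thesis
        using C(2)[of "(u, \<xi>)" "map (Pair 0) vs"] that by (simp add: o_def norm_Pair)
    qed
    then show ?thesis using C(1) by blast
  qed
  \<comment> \<open>Radius 0, because the model involves derivatives at the origin only.\<close>
  obtain C1 where C1: "C1 \<ge> 0" "\<And>u \<xi> vs. u \<in> Q \<Longrightarrow> \<xi> \<in> cball 0 0 \<Longrightarrow> length vs = 1 \<Longrightarrow>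
      \<bar>dir_derivs vs (\<lambda>\<xi>. F c (u, \<xi>)) \<xi>\<bar> \<le> C1 * (\<Prod>v\<leftarrow>vs. norm v)"
    using bound[of 1 0] by auto
  obtain C2 where C2: "C2 \<ge> 0" "\<And>u \<xi> vs. u \<in> Q \<Longrightarrow> \<xi> \<in> cball 0 0 \<Longrightarrow> length vs = 2 \<Longrightarrow>
      \<bar>dir_derivs vs (\<lambda>\<xi>. F c (u, \<xi>)) \<xi>\<bar> \<le> C2 * (\<Prod>v\<leftarrow>vs. norm v)"
    using bound[of 2 0] by auto
  \<comment> \<open>The threshold of \<open>cubic_step_bound\<close>: the cubic coefficient is
    \<open>\<sigma>min / 3\<close> with the norm comparison \<open>a\<close> cubed, and the
    quadratic one carries the Taylor factor 1/2.\<close>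
  define r where "r = max 1 ((C1 + C2 / 2) / (\<sigma>min / 3 * a ^ 3))"
  obtain C3 where C3: "C3 \<ge> 0" "\<And>u \<xi> vs. u \<in> Q \<Longrightarrow> \<xi> \<in> cball 0 r \<Longrightarrow> length vs = 3 \<Longrightarrow>
      \<bar>dir_derivs vs (\<lambda>\<xi>. F c (u, \<xi>)) \<xi>\<bar> \<le> C3 * (\<Prod>v\<leftarrow>vs. norm v)"
    using bound[of 3 r] by auto
  \<comment> \<open>The third derivative takes three arguments; each passage from coordinate norm to
    Riemannian norm costs a factor \<open>1 / a\<close>.\<close>
  define L where "L = C3 / a ^ 3"
  have "L \<ge> 0" using C3(1) a(1) by (simp add: L_def)
  have "cubic_bound M L y (pullback R f y) s"
    if y: "y \<in> chart_dom c" "chart_map c y \<in> Q" and \<sigma>: "\<sigma> \<ge> \<sigma>min" and s: "s \<in> tspace M y"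
      and dec: "arc_model M R f y \<sigma> s \<le> arc_model M R f y \<sigma> 0" for y \<sigma> s
  proof -
    have cy: "c \<in> charts_at M y" using c y by (simp add: charts_at_def)
    note carr = charts_at_carrier[OF rm cy]
    let ?h = "pullback R f y" and ?\<xi> = "s c" and ?n = "norm (s c)" and ?N = "tnorm M y s"
    define \<phi> where "\<phi> = (\<lambda>\<xi>. ?h (tlift M c y \<xi>))"
    have sec: "(\<lambda>\<xi>. ?h (tlift M d y \<xi>)) = (\<lambda>\<xi>. F d (chart_map d y, \<xi>))" if "d \<in> charts_at M y" for d
      using chart_inv_map[OF sm, of d y] that by (simp add: F_def charts_at_def)
    have Ch: "Ck_on 3 UNIV (\<lambda>\<xi>. ?h (tlift M d y \<xi>))" if "d \<in> charts_at M y" for d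
      unfolding sec[OF that]
      by (rule Ck_on_section[OF chart_homeo(3)[OF sm] CF]) (use that in \<open>auto simp: charts_at_def chart_img_def\<close>)
    have C2h: "Ck_on 2 UNIV (\<lambda>\<xi>. ?h (tlift M d y \<xi>))" if "d \<in> charts_at M y" for d
      by (rule Ck_on_le[OF Ch[OF that]]) simp
    have \<phi>: "\<phi> = (\<lambda>\<xi>. F c (chart_map c y, \<xi>))" unfolding \<phi>_def by (rule sec[OF cy])
    have C\<phi>: "Ck_on 3 UNIV \<phi>" using Ch[OF cy] by (simp add: \<phi>_def)
    note taylor = taylor2_coord[OF rm _ cy, of ?h]
    have t2: "taylor2 M y ?h v = \<phi> 0 + ddir (v c) \<phi> 0 + ddir (v c) (ddir (v c) \<phi>) 0 / 2"
      if "v \<in> tspace M y" for v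
      using taylor(1)[OF _ that] C2h unfolding \<phi>_def by blast
    define E where "E = tgrad M y ?h s - tgrad M y ?h 0 - thess M y ?h 0 s"
    have E: "E \<in> tspace M y"
      "\<And>w. w \<in> tspace M y \<Longrightarrow> rmetric M y E w = ddir (w c) \<phi> ?\<xi> - ddir (w c) \<phi> 0 - ddir ?\<xi> (ddir (w c) \<phi>) 0"
      using taylor(2,3)[OF _ s] C2h unfolding E_def \<phi>_def by blast+
    have n: "a * ?n \<le> ?N" using a(2)[OF y s] .
    have N: "?N \<ge> 0" using tnorm_nonneg[OF rm carr s] .
    have zero: "0 \<in> tspace M y" using subspace_0[OF subspace_tspace[OF sm]] .
    have lin0: "ddir 0 g 0 = 0" if "g differentiable (at 0)" for g :: "'e \<Rightarrow> real"
      using that by (intro linear_0 linear_frechet_derivative)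
    have "ddir 0 \<phi> 0 = 0" "ddir 0 (ddir 0 \<phi>) 0 = 0"
      using C\<phi> by (simp_all add: lin0 numeral_3_eq_3)
    then have "taylor2 M y ?h 0 = \<phi> 0" using t2[OF zero] by simp
    moreover have "tnorm M y 0 = 0"
      using rmetric_zero_left[OF rm carr zero] by (simp add: tnorm_def)
    \<comment> \<open>The constant term \<phi>(0) cancels, so the cubic term is bounded by the
      linear and quadratic ones.\<close>
    ultimately have dec': "ddir ?\<xi> \<phi> 0 + ddir ?\<xi> (ddir ?\<xi> \<phi>) 0 / 2 + \<sigma> / 3 * ?N ^ 3 \<le> 0"
      using dec t2[OF s] by (simp add: arc_model_def)
    have "?n \<le> r"
      unfolding r_def
    proof (rule cubic_step_bound)
      have "\<sigma>min / 3 * a ^ 3 * ?n ^ 3 = \<sigma>min / 3 * (a * ?n) ^ 3" by (simp add: power_mult_distrib)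
      also have "\<dots> \<le> \<sigma> / 3 * ?N ^ 3"
        using \<sigma> \<sigma>min a(1) n by (intro mult_mono power_mono) auto
      also have "\<dots> \<le> \<bar>ddir ?\<xi> \<phi> 0\<bar> + \<bar>ddir ?\<xi> (ddir ?\<xi> \<phi>) 0\<bar> / 2" using dec' by linarith
      also have "\<dots> \<le> C1 * ?n + C2 * ?n\<^sup>2 / 2"
        using C1(2)[OF y(2), of 0 "[?\<xi>]"] C2(2)[OF y(2), of 0 "[?\<xi>, ?\<xi>]"]
        by (simp add: \<phi>[symmetric] power2_eq_square)
      finally show "\<sigma>min / 3 * a ^ 3 * ?n ^ 3 \<le> C1 * ?n + C2 / 2 * ?n\<^sup>2" by simp
    qed (use C1 C2 \<sigma>min a in auto)
    then have seg: "t *\<^sub>R ?\<xi> \<in> cball 0 r" if "0 \<le> t" "t \<le> 1" for t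
      using that mult_left_le_one_le[of ?n t] by simp
    have third: "\<bar>dir_derivs vs \<phi> (t *\<^sub>R ?\<xi>)\<bar> \<le> C3 * (\<Prod>v\<leftarrow>vs. norm v)"
      if "length vs = 3" "0 \<le> t" "t \<le> 1" for vs t
      unfolding \<phi> using C3(2)[OF y(2) seg] that by simp
    have "(\<Sum>m<3. dir_derivs (replicate m ?\<xi>) \<phi> 0 / fact m) =
        \<phi> 0 + ddir ?\<xi> \<phi> 0 + ddir ?\<xi> (ddir ?\<xi> \<phi>) 0 / 2"
      by (simp add: eval_nat_numeral)
    moreover have "\<bar>\<phi> ?\<xi> - (\<Sum>m<3. dir_derivs (replicate m ?\<xi>) \<phi> 0 / fact m)\<bar> \<le> C3 * ?n ^ 3 / fact 3"
      by (rule taylor_line_bound[OF C\<phi>])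
        (use third[of "replicate 3 ?\<xi>"] in \<open>auto simp: numeral_3_eq_3\<close>)
    ultimately have "\<phi> ?\<xi> - (\<phi> 0 + ddir ?\<xi> \<phi> 0 + ddir ?\<xi> (ddir ?\<xi> \<phi>) 0 / 2) \<le> C3 * ?n ^ 3 / fact 3"
      by linarith
    moreover have "C3 * ?n ^ 3 \<le> L * ?N ^ 3"
    proof -
      have "C3 * ?n ^ 3 = L * (a * ?n) ^ 3" using a(1) by (simp add: L_def power_mult_distrib)
      also have "\<dots> \<le> L * ?N ^ 3" using \<open>L \<ge> 0\<close> n a(1) by (intro mult_left_mono power_mono) auto
      finally show ?thesis .
    qed
    ultimately have first: "?h s - taylor2 M y ?h s \<le> L / 6 * ?N ^ 3"
      using t2[OF s] tlift_coord[OF sm cy s] by (simp add: \<phi>_def fact_numeral)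
    \<comment> \<open>Pairing \<open>E\<close> with itself: \<open>?X\<^sup>2\<close> is the
      first-order Taylor remainder at \<open>?\<xi>\<close> of the scalar function
      \<open>ddir (E c) \<phi>\<close>, so \<open>E c\<close> is one of the three directions of the
      third derivative.\<close>
    let ?X = "tnorm M y E"
    have X: "?X \<ge> 0" using tnorm_nonneg[OF rm carr E(1)] .
    have "(\<Sum>m<2. dir_derivs (replicate m ?\<xi>) (ddir (E c) \<phi>) 0 / fact m) =
        ddir (E c) \<phi> 0 + ddir ?\<xi> (ddir (E c) \<phi>) 0"
      by (simp add: eval_nat_numeral)
    moreover have "\<bar>ddir (E c) \<phi> ?\<xi> - (\<Sum>m<2. dir_derivs (replicate m ?\<xi>) (ddir (E c) \<phi>) 0 / fact m)\<bar>
        \<le> C3 * (norm (E c) * ?n\<^sup>2) / fact 2"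
      by (rule taylor_line_bound[of 2 UNIV])
        (use third[of "E c # replicate 2 ?\<xi>"] C\<phi> in \<open>auto simp: numeral_2_eq_2 numeral_3_eq_3\<close>)
    ultimately have "?X\<^sup>2 \<le> C3 * (norm (E c) * ?n\<^sup>2) / fact 2"
      unfolding tnorm_square[OF rm carr E(1)] E(2)[OF E(1)] by linarith
    \<comment> \<open>Of the three factors \<open>a\<close> hidden in \<open>L\<close>, two go to
      the step and one to \<open>E c\<close>; the norm comparison is then applied to both
      vectors.\<close>
    also have "\<dots> = L / 2 * (a * ?n)\<^sup>2 * (a * norm (E c))"
      using a(1) by (simp add: L_def power2_eq_square power3_eq_cube)
    also have "\<dots> \<le> L / 2 * ?N\<^sup>2 * ?X"
      using \<open>L \<ge> 0\<close> a n a(2)[OF y E(1)] N by (intro mult_mono power_mono) auto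
    finally have "?X * ?X \<le> (L / 2 * ?N\<^sup>2) * ?X" by (simp add: power2_eq_square)
    then have "?X \<le> L / 2 * ?N\<^sup>2"
      using X \<open>L \<ge> 0\<close> by (cases "?X = 0") auto
    with first show ?thesis by (simp add: cubic_bound_def E_def)
  qed
  then show ?thesis using \<open>L \<ge> 0\<close> by blast
qed

lemma compact_cubic_bound:
  fixes M :: "('m, 'e::euclidean_space) manifold"
  assumes rm: "riemannian_manifold M" and R: "retraction_on M R" and f: "Ck_function 3 M f"
    and K: "compactin (mtop M) K" and \<sigma>min: "\<sigma>min > 0"
  shows "\<exists>L. \<forall>y\<in>K. \<forall>\<sigma>\<ge>\<sigma>min. \<forall>s\<in>tspace M y.
    arc_model M R f y \<sigma> s \<le> arc_model M R f y \<sigma> 0 \<longrightarrow> cubic_bound M L y (pullback R f y) s"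
proof -
  note sm = smooth_riemannian[OF rm]
  define good where "good L U \<longleftrightarrow> (\<forall>y\<in>U. \<forall>\<sigma>\<ge>\<sigma>min. \<forall>s\<in>tspace M y.
    arc_model M R f y \<sigma> s \<le> arc_model M R f y \<sigma> 0 \<longrightarrow> cubic_bound M L y (pullback R f y) s)" for L U
  have "\<exists>U. openin (mtop M) U \<and> p \<in> U \<and> (\<exists>L\<ge>0. good L U)" if "p \<in> K" for p
  proof -
    have "p \<in> carrier M" using that compactin_subset_topspace[OF K] by (auto simp: carrier_def)
    then obtain c where c: "c \<in> atlas M" "p \<in> chart_dom c"
      using charts_at_nonempty[OF sm] unfolding charts_at_def by blast
    then have "chart_map c p \<in> chart_img c" by (auto simp: chart_img_def)
    then obtain e where e: "e > 0" "cball (chart_map c p) e \<subseteq> chart_img c"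
      using chart_homeo(3)[OF sm c(1)] open_contains_cball by blast
    \<comment> \<open>The constant comes from the compact closed ball, but a cover needs open sets,
      hence the preimage of the open ball.\<close>
    obtain L where "L \<ge> 0" "good L {y \<in> chart_dom c. chart_map c y \<in> ball (chart_map c p) e}"
      using local_cubic_bound[OF rm R f c(1) compact_cball e(2) \<sigma>min] unfolding good_def by fastforce
    then show ?thesis
      using chart_preimage_open[OF sm c(1) open_ball] c(2) e(1)
      by (intro exI[of _ "{y \<in> chart_dom c. chart_map c y \<in> ball (chart_map c p) e}"]) auto
  qed
  then obtain U L where U: "\<And>p. p \<in> K \<Longrightarrow> openin (mtop M) (U p) \<and> p \<in> U p \<and> L p \<ge> 0 \<and> good (L p) (U p)"
    by metis
  obtain P where P: "finite P" "P \<subseteq> K" "K \<subseteq> \<Union> (U ` P)"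
  proof -
    have "\<exists>\<F>. finite \<F> \<and> \<F> \<subseteq> U ` K \<and> K \<subseteq> \<Union>\<F>"
      using K U unfolding compactin_def by (elim conjE allE[of _ "U ` K"]) blast
    then show ?thesis using that by (metis finite_subset_image)
  qed
  \<comment> \<open>The local constants are nonnegative, so their sum dominates each of them; unlike
    a maximum, it also makes sense for an empty subcover.\<close>
  have "good (sum L P) K"
    unfolding good_def
  proof (intro ballI allI impI)
    fix y \<sigma> s
    assume y: "y \<in> K" and H: "\<sigma>min \<le> \<sigma>" "s \<in> tspace M y" "arc_model M R f y \<sigma> s \<le> arc_model M R f y \<sigma> 0"
    then obtain p where p: "p \<in> P" "y \<in> U p" using P(3) by auto
    then have "cubic_bound M (L p) y (pullback R f y) s"
      using U[of p] P(2) H unfolding good_def by blast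
    moreover have "L p \<le> sum L P" using U P(1,2) p(1) by (intro member_le_sum) auto
    moreover have "y \<in> carrier M" using y compactin_subset_topspace[OF K] by (auto simp: carrier_def)
    ultimately show "cubic_bound M (sum L P) y (pullback R f y) s"
      by (rule cubic_bound_mono[OF _ _ tnorm_nonneg[OF rm _ H(2)]])
  qed
  then show ?thesis unfolding good_def by blast
qed

subsection \<open>Invariants of the algorithm\<close>

text \<open>For a nonzero step the denominator of the ratio is positive, being a nonnegative model
  decrease plus a positive cubic term; a ratio of at least \<open>\<eta>1 > 0\<close> thus makes the
  numerator positive. The lower bound on \<sigma> survives a rejected step because
  \<open>\<gamma>2 > 1\<close>.\<close>

lemma arc_run_step:
  assumes rm: "riemannian_manifold M" and R: "retraction_on M R"
    and run: "arc_run M R f so \<theta> \<sigma>min \<eta>1 \<eta>2 \<gamma>1 \<gamma>2 \<gamma>3 x s \<sigma>"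
    and par: "\<sigma>min > 0" "\<eta>1 > 0" "\<gamma>2 > 1"
    and k: "arc_executed s (Suc k)" "x k \<in> carrier M" "\<sigma> k \<ge> \<sigma>min"
  shows "x (Suc k) \<in> carrier M" "\<sigma> (Suc k) \<ge> \<sigma>min" "f (x (Suc k)) \<le> f (x k)"
proof -
  define \<rho> where "\<rho> = arc_ratio M R f (x k) (\<sigma> k) (s k)"
  \<comment> \<open>Execution of iteration \<open>Suc k\<close> encodes that step \<open>k\<close>
    did not terminate the algorithm.\<close>
  have "arc_executed s k" "s k \<noteq> 0" using k(1) by (auto simp: arc_executed_def)
  then have step: "arc_step M R f so \<theta> (x k) (\<sigma> k) (s k)"
    and x: "x (Suc k) = (if \<rho> \<ge> \<eta>1 then R (x k) (s k) else x k)"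
    and \<sigma>: "\<sigma> (Suc k) \<in> (if \<rho> \<ge> \<eta>2 then {max \<sigma>min (\<gamma>1 * \<sigma> k)..\<sigma> k}
                else if \<rho> \<ge> \<eta>1 then {\<sigma> k..\<gamma>2 * \<sigma> k} else {\<gamma>2 * \<sigma> k..\<gamma>3 * \<sigma> k})"
    using run unfolding arc_run_def \<rho>_def Let_def by blast+
  have s: "s k \<in> tspace M (x k)" and dec: "arc_model M R f (x k) (\<sigma> k) (s k) \<le> arc_model M R f (x k) (\<sigma> k) 0"
    using step unfolding arc_step_def Let_def by auto
  show "x (Suc k) \<in> carrier M" using x R s k(2) unfolding retraction_on_def by auto
  have "\<sigma> k \<le> \<gamma>2 * \<sigma> k" using par k(3) by simp
  then show "\<sigma> (Suc k) \<ge> \<sigma>min" using \<sigma> k(3) by (auto split: if_splits)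
  define D where "D = arc_model M R f (x k) (\<sigma> k) 0 - arc_model M R f (x k) (\<sigma> k) (s k)
      + \<sigma> k / 3 * tnorm M (x k) (s k) ^ 3"
  have "\<sigma> k / 3 * tnorm M (x k) (s k) ^ 3 > 0"
    using tnorm_pos[OF rm k(2) s \<open>s k \<noteq> 0\<close>] k(3) par(1) by simp
  then have "D > 0" using dec by (simp add: D_def)
  have "f (x k) - f (R (x k) (s k)) \<ge> 0" if "\<rho> \<ge> \<eta>1"
  proof -
    have "(f (x k) - f (R (x k) (s k))) / D > 0"
      using that par(2) by (simp add: \<rho>_def arc_ratio_def D_def)
    then show ?thesis using \<open>D > 0\<close> by (simp add: zero_less_divide_iff)
  qed
  then show "f (x (Suc k)) \<le> f (x k)" using x by simp
qed

text \<open>The three facts share one induction, since descent relies on the other two. The bound on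
  \<sigma> feeds the uniform estimate, and the bound on \<open>f\<close> places the iterates in the
  initial sublevel set.\<close>

lemma arc_run_invariant:
  assumes rm: "riemannian_manifold M" and R: "retraction_on M R"
    and run: "arc_run M R f so \<theta> \<sigma>min \<eta>1 \<eta>2 \<gamma>1 \<gamma>2 \<gamma>3 x s \<sigma>"
    and par: "\<sigma>min > 0" "\<eta>1 > 0" "\<gamma>2 > 1"
    and k: "arc_executed s k"
  shows "x k \<in> carrier M \<and> \<sigma> k \<ge> \<sigma>min \<and> f (x k) \<le> f (x 0)"
  using k
proof (induction k)
  case 0
  show ?case using run unfolding arc_run_def by simp
next
  case (Suc k)
  have "arc_executed s k" using Suc.prems by (auto simp: arc_executed_def)
  then show ?case
    using Suc.IH arc_run_step[OF rm R run par Suc.prems] by fastforce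
qed

theorem theorem6:
  fixes M :: "('m, 'e::euclidean_space) manifold"
    and R :: "'m \<Rightarrow> ('m, 'e) tvec \<Rightarrow> 'm"
    and f :: "'m \<Rightarrow> real"
    and so :: bool
    and \<theta> \<sigma>min \<eta>1 \<eta>2 \<gamma>1 \<gamma>2 \<gamma>3 :: real
    and x :: "nat \<Rightarrow> 'm"
    and s :: "nat \<Rightarrow> ('m, 'e) tvec"
    and \<sigma> :: "nat \<Rightarrow> real"
  assumes "riemannian_manifold M"
    and "retraction_on M R"
    and "Ck_function 3 M f"
    and "\<theta> > 0" and "\<sigma>min > 0"
    and "0 < \<eta>1" and "\<eta>1 \<le> \<eta>2" and "\<eta>2 < 1"
    and "0 < \<gamma>1" and "\<gamma>1 < 1" and "1 < \<gamma>2" and "\<gamma>2 < \<gamma>3"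
    and "arc_run M R f so \<theta> \<sigma>min \<eta>1 \<eta>2 \<gamma>1 \<gamma>2 \<gamma>3 x s \<sigma>"
    and "second_order_nice M R {(x k, s k) | k. arc_executed s k}"
  shows
    "(iterates_in_compact M x s \<longrightarrow>
       (\<exists>L. \<forall>k. arc_executed s k \<longrightarrow>
          pullback R f (x k) (s k) - taylor2 M (x k) (pullback R f (x k)) (s k)
            \<le> L / 6 * tnorm M (x k) (s k) ^ 3 \<and>
          (arc_successful M R f \<eta>1 x s \<sigma> k \<longrightarrow>
             tnorm M (x k)
               (tgrad M (x k) (pullback R f (x k)) (s k)
                - tgrad M (x k) (pullback R f (x k)) 0
                - thess M (x k) (pullback R f (x k)) 0 (s k))
             \<le> L / 2 * (tnorm M (x k) (s k))\<^sup>2)))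
     \<and> (\<forall>k. arc_executed s (Suc k) \<longrightarrow> f (x (Suc k)) \<le> f (x k))
     \<and> (compactin (mtop M) {p \<in> carrier M. f p \<le> f (x 0)} \<longrightarrow> iterates_in_compact M x s)
     \<and> (compact_space (mtop M) \<longrightarrow>
          compactin (mtop M) {p \<in> carrier M. f p \<le> f (x 0)} \<and> iterates_in_compact M x s)"
proof -
  note rm = assms(1) and R = assms(2) and f = assms(3) and run = assms(13)
  note par = \<open>\<sigma>min > 0\<close> \<open>0 < \<eta>1\<close> \<open>1 < \<gamma>2\<close>
  note inv = arc_run_invariant[OF rm R run par]
  have step: "s k \<in> tspace M (x k)" "arc_model M R f (x k) (\<sigma> k) (s k) \<le> arc_model M R f (x k) (\<sigma> k) 0"
    if "arc_executed s k" for k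
    using run that unfolding arc_run_def arc_step_def Let_def by blast+
  have bounds: "\<exists>L. \<forall>k. arc_executed s k \<longrightarrow> cubic_bound M L (x k) (pullback R f (x k)) (s k)"
    if compact: "iterates_in_compact M x s"
  proof -
    obtain K where K: "compactin (mtop M) K" "\<And>k. arc_executed s k \<Longrightarrow> x k \<in> K"
      using compact unfolding iterates_in_compact_def by blast
    \<comment> \<open>The run enters only through membership in \<open>K\<close>, the lower bound on
      \<sigma> and the model decrease, so one constant serves all executed iterations.\<close>
    from compact_cubic_bound[OF rm R f K(1) par(1)] show ?thesis
      using K(2) inv step by blast
  qed
  have descent: "f (x (Suc k)) \<le> f (x k)" if "arc_executed s (Suc k)" for k
  proof -
    have "arc_executed s k" using that by (auto simp: arc_executed_def)
    then show ?thesis using arc_run_step(3)[OF rm R run par that] inv by blast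
  qed
  have sub: "iterates_in_compact M x s" if "compactin (mtop M) {p \<in> carrier M. f p \<le> f (x 0)}"
    unfolding iterates_in_compact_def using that inv
    by (intro exI[of _ "{p \<in> carrier M. f p \<le> f (x 0)}"]) auto
  have comp: "compactin (mtop M) {p \<in> carrier M. f p \<le> f (x 0)}" if "compact_space (mtop M)"
  proof (rule closedin_compact_space[OF that])
    have "closedin (mtop M) {p \<in> topspace (mtop M). f p \<in> {..f (x 0)}}"
      by (rule closedin_continuous_map_preimage[OF continuous_map_Ck_function[OF smooth_riemannian[OF rm] f]]) simp
    then show "closedin (mtop M) {p \<in> carrier M. f p \<le> f (x 0)}" by (simp add: carrier_def)
  qed
  show ?thesis
    using bounds descent sub comp unfolding cubic_bound_def by blast
qed

end
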